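(* Let $n>1$ and let $(X,g)$ be the LeBrun negative mass ALE metric on $\mathcal{O}(-n)$, with orbifold conformal compactification $(\hat X,[\hat g])$. Then there is no symmetric solution of the orbifold Yamabe problem on $(\hat X,\hat g)$ invariant under $\mathrm{SU}(2)$; that is, there is no smooth orbifold metric on $\hat X$ conformal to $\hat g$ which has constant scalar curvature and is invariant under $\mathrm{SU}(2)$.
   Context: **The metric.** Let $\{\sigma_1,\sigma_2,\sigma_3\}$ be a left-invariant coframe on $S^3=\mathrm{SU}(2)$, normalized so that $\sigma_1^2+\sigma_2^2+\sigma_3^2$ is the unit round metric. For an integer $n\ge1$ put $A=n-2$, $B=1-n$ and, for $r>1$, $$g=\frac{dr^2}{1+Ar^{-2}+Br^{-4}}+r^2\Big[\sigma_1^2+\sigma_2^2+(1+Ar^{-2}+Br^{-4})\sigma_3^2\Big].$$ Redefine the radial coordinate by $\hat r^2=r^2-1$, attach a $\mathbb{CP}^1$ at $\hat r=0$, and take the quotient by the cyclic group $\mathbb{Z}_n$ acting along the circle generated by the vector field dual to $\sigma_3$; the metric then extends smoothly over this $\mathbb{CP}^1$, giving a complete scalar-flat Kähler ALE metric $(X,g)$ on a manifold $X$ diffeomorphic to the total space of $\mathcal{O}(-n)\to\mathbb{CP}^1$. This is LeBrun's (negative mass) ALE metric on $\mathcal{O}(-n)$. (The name is used for all $n$; for $n=2$ it is the Eguchi–Hanson metric.) The identity component of its isometry group is $\mathrm{U}(2)$ (up to a finite quotient); the subgroup $\mathrm{SU}(2)$ meant here is induced by left multiplication on $S^3=\mathrm{SU}(2)$,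 and acts on $\hat X$ fixing the added point. **Orbifold conformal compactification.** One chooses $u:X\to\mathbb{R}_+$ with $u=O(r^{-2})$ as $r\to\infty$ such that $u^2g$ extends to a $C^\infty$ orbifold metric $\hat g$ on $\hat X=X\cup\{\infty\}$, the added point being an isolated orbifold point with group of order $n$ (such $u$ exists). A solution of the orbifold Yamabe problem on $(\hat X,\hat g)$ is a smooth orbifold metric conformal to $\hat g$ with constant scalar curvature. *)

theory Defs
  imports "HOL-Analysis.Analysis" "HOL-Library.Landau_Symbols"
begin

section \<open>Smooth maps on open sets\<close>

primrec Ck_on :: "nat \<Rightarrow> 'a::euclidean_space set \<Rightarrow> ('a \<Rightarrow> 'b::real_normed_vector) \<Rightarrow> bool" where
  "Ck_on 0 S f \<longleftrightarrow> continuous_on S f"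
| "Ck_on (Suc k) S f \<longleftrightarrow> (\<forall>x\<in>S. f differentiable (at x)) \<and>
     (\<forall>v. Ck_on k S (\<lambda>x. frechet_derivative f (at x) v))"

definition smooth_on :: "'a::euclidean_space set \<Rightarrow> ('a \<Rightarrow> 'b::real_normed_vector) \<Rightarrow> bool" where
  "smooth_on S f \<longleftrightarrow> (\<forall>k. Ck_on k S f)"

section \<open>Riemannian metrics on open subsets of a Euclidean space\<close>

text \<open>A metric tensor assigns to a point \<open>x\<close> the bilinear form \<open>g x\<close> on the tangent space at
  \<open>x\<close>, which is identified with the ambient vector space.\<close>

type_synonym 'e metric_tensor = "'e \<Rightarrow> 'e \<Rightarrow> 'e \<Rightarrow> real"

definition riemannian_metric_on :: "'e::euclidean_space set \<Rightarrow> 'e metric_tensor \<Rightarrow> bool" where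
  "riemannian_metric_on U g \<longleftrightarrow>
     (\<forall>x\<in>U. bilinear (g x) \<and> (\<forall>v w. g x v w = g x w v) \<and> (\<forall>v. v \<noteq> 0 \<longrightarrow> g x v v > 0)) \<and>
     (\<forall>v w. smooth_on U (\<lambda>x. g x v w))"

text \<open>Components are taken with respect to the linear coordinates given by \<open>Basis\<close>.
  \<open>metric_inv g x\<close> is the inverse of the Gram matrix: \<open>metric_op g x\<close> is the linear map with
  \<open>metric_op g x v \<bullet> w = g x v w\<close>.\<close>

definition metric_op :: "'e::euclidean_space metric_tensor \<Rightarrow> 'e \<Rightarrow> 'e \<Rightarrow> 'e" where
  "metric_op g x v = (\<Sum>i\<in>Basis. g x v i *\<^sub>R i)"

definition metric_inv :: "'e::euclidean_space metric_tensor \<Rightarrow> 'e metric_tensor" where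
  "metric_inv g x i j = inv (metric_op g x) i \<bullet> j"

definition partial :: "'e::euclidean_space \<Rightarrow> ('e \<Rightarrow> real) \<Rightarrow> 'e \<Rightarrow> real" where
  "partial i f x = frechet_derivative f (at x) i"

definition christoffel ::
  "'e::euclidean_space metric_tensor \<Rightarrow> 'e \<Rightarrow> 'e \<Rightarrow> 'e \<Rightarrow> 'e \<Rightarrow> real" where
  "christoffel g k i j x = (1/2) * (\<Sum>l\<in>Basis. metric_inv g x k l *
     (partial i (\<lambda>y. g y j l) x + partial j (\<lambda>y. g y i l) x - partial l (\<lambda>y. g y i j) x))"

text \<open>\<open>riemann g l k i j\<close> is the coefficient of \<open>l\<close> in \<open>R(i,j)k\<close>, where
  \<open>R(X,Y) = [\<nabla>\<^sub>X,\<nabla>\<^sub>Y] - \<nabla>\<^sub>[\<^sub>X\<^sub>,\<^sub>Y\<^sub>]\<close>; with these conventions round spheres have positive scalar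
  curvature.\<close>

definition riemann ::
  "'e::euclidean_space metric_tensor \<Rightarrow> 'e \<Rightarrow> 'e \<Rightarrow> 'e \<Rightarrow> 'e \<Rightarrow> 'e \<Rightarrow> real" where
  "riemann g l k i j x =
     partial i (christoffel g l j k) x - partial j (christoffel g l i k) x +
     (\<Sum>m\<in>Basis. christoffel g l i m x * christoffel g m j k x -
                 christoffel g l j m x * christoffel g m i k x)"

definition ricci :: "'e::euclidean_space metric_tensor \<Rightarrow> 'e \<Rightarrow> 'e \<Rightarrow> 'e \<Rightarrow> real" where
  "ricci g j k x = (\<Sum>i\<in>Basis. riemann g i k i j x)"

definition scalar_curvature :: "'e::euclidean_space metric_tensor \<Rightarrow> 'e \<Rightarrow> real" where
  "scalar_curvature g x = (\<Sum>j\<in>Basis. \<Sum>k\<in>Basis. metric_inv g x j k * ricci g j k x)"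

section \<open>Orbifold charts and orbifold metrics\<close>

text \<open>An orbifold chart consists of an open set (the local uniformization) and the map from it
  onto an open subset of the orbifold. The local group is not recorded: it is recovered as the
  group of smooth lifts of the identity from the chart to itself.\<close>

record ('e, 'p) orbichart =
  cdom :: "'e set"
  cmap :: "'e \<Rightarrow> 'p"

definition local_lift ::
  "('p \<Rightarrow> 'p) \<Rightarrow> ('e::euclidean_space, 'p) orbichart \<Rightarrow> ('e, 'p) orbichart \<Rightarrow> 'e set \<Rightarrow> ('e \<Rightarrow> 'e) \<Rightarrow> bool"
where
  "local_lift F C D V l \<longleftrightarrow> open V \<and> V \<subseteq> cdom C \<and> smooth_on V l \<and> l ` V \<subseteq> cdom D \<and>
     (\<forall>x\<in>V. cmap D (l x) = F (cmap C x))"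

text \<open>A tensor on an orbifold is a family of tensors, one on each chart domain.\<close>

type_synonym ('e, 'p) orbitensor = "('e, 'p) orbichart \<Rightarrow> 'e metric_tensor"

definition preserves_metric ::
  "('e::euclidean_space, 'p) orbichart set \<Rightarrow> ('p \<Rightarrow> 'p) \<Rightarrow> ('e, 'p) orbitensor \<Rightarrow> bool" where
  "preserves_metric \<A> F h \<longleftrightarrow>
     (\<forall>C\<in>\<A>. \<forall>D\<in>\<A>. \<forall>V l. local_lift F C D V l \<longrightarrow>
        (\<forall>x\<in>V. \<forall>v w. h D (l x) (frechet_derivative l (at x) v) (frechet_derivative l (at x) w)
                     = h C x v w))"

text \<open>The second condition, with \<open>F = id\<close>, says that the local metrics agree under all changes of
  charts and are invariant under the local groups.\<close>

definition orbifold_metric ::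
  "('e::euclidean_space, 'p) orbichart set \<Rightarrow> ('e, 'p) orbitensor \<Rightarrow> bool" where
  "orbifold_metric \<A> h \<longleftrightarrow>
     (\<forall>C\<in>\<A>. riemannian_metric_on (cdom C) (h C)) \<and> preserves_metric \<A> id h"

definition orbifold_smooth ::
  "('e::euclidean_space, 'p) orbichart set \<Rightarrow> ('p \<Rightarrow> real) \<Rightarrow> bool" where
  "orbifold_smooth \<A> f \<longleftrightarrow> (\<forall>C\<in>\<A>. smooth_on (cdom C) (\<lambda>x. f (cmap C x)))"

definition conformal_metrics ::
  "('e::euclidean_space, 'p) orbichart set \<Rightarrow> ('e, 'p) orbitensor \<Rightarrow> ('e, 'p) orbitensor \<Rightarrow> bool" where
  "conformal_metrics \<A> h0 h \<longleftrightarrow>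
     (\<exists>f. orbifold_smooth \<A> f \<and>
        (\<forall>C\<in>\<A>. \<forall>x\<in>cdom C. f (cmap C x) > 0 \<and>
           (\<forall>v w. h C x v w = f (cmap C x) * h0 C x v w)))"

definition constant_scalar_curvature ::
  "('e::euclidean_space, 'p) orbichart set \<Rightarrow> ('e, 'p) orbitensor \<Rightarrow> bool" where
  "constant_scalar_curvature \<A> h \<longleftrightarrow>
     (\<exists>c. \<forall>C\<in>\<A>. \<forall>x\<in>cdom C. scalar_curvature (h C) x = c)"

definition yamabe_solution ::
  "('e::euclidean_space, 'p) orbichart set \<Rightarrow> ('e, 'p) orbitensor \<Rightarrow> ('e, 'p) orbitensor \<Rightarrow> bool" where
  "yamabe_solution \<A> h0 h \<longleftrightarrow>
     orbifold_metric \<A> h \<and> conformal_metrics \<A> h0 h \<and> constant_scalar_curvature \<A> h"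

section \<open>The left-invariant coframe\<close>

type_synonym C2 = "complex \<times> complex"

definition cscale :: "complex \<Rightarrow> C2 \<Rightarrow> C2" where
  "cscale c z = (c * fst z, c * snd z)"

text \<open>The unit sphere is identified with SU(2) by taking the first column \<open>(a, b)\<close> of the matrix
  with rows \<open>(a, - cnj b)\<close>, \<open>(b, cnj a)\<close>. Left multiplication on SU(2) becomes the linear action
  on \<open>C2\<close>, the vector fields \<open>(- cnj b, cnj a)\<close>, \<open>(- \<i> cnj b, \<i> cnj a)\<close>, \<open>(\<i> a, \<i> b)\<close> are
  left-invariant and orthonormal, and the flow of the last one is scalar multiplication by unit
  complex numbers. The forms below are the dual coframe, pulled back by \<open>z \<mapsto> z / |z|\<close>.\<close>

definition sigma1 :: "C2 \<Rightarrow> C2 \<Rightarrow> real" where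
  "sigma1 z v = (- cnj (snd z), cnj (fst z)) \<bullet> v / (norm z)\<^sup>2"

definition sigma2 :: "C2 \<Rightarrow> C2 \<Rightarrow> real" where
  "sigma2 z v = (- \<i> * cnj (snd z), \<i> * cnj (fst z)) \<bullet> v / (norm z)\<^sup>2"

definition sigma3 :: "C2 \<Rightarrow> C2 \<Rightarrow> real" where
  "sigma3 z v = (\<i> * fst z, \<i> * snd z) \<bullet> v / (norm z)\<^sup>2"

definition dr :: "C2 \<Rightarrow> C2 \<Rightarrow> real" where
  "dr z v = frechet_derivative norm (at z) v"

definition lebrun_F :: "nat \<Rightarrow> real \<Rightarrow> real" where
  "lebrun_F n r = 1 + (real n - 2) / r ^ 2 + (1 - real n) / r ^ 4"

definition lebrun_tensor :: "nat \<Rightarrow> C2 metric_tensor" where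
  "lebrun_tensor n z v w =
     (let r = norm z in
        dr z v * dr z w / lebrun_F n r +
        r\<^sup>2 * (sigma1 z v * sigma1 z w + sigma2 z v * sigma2 z w +
              lebrun_F n r * (sigma3 z v * sigma3 z w)))"

section \<open>The space \<open>\<O>(-n)\<close> and its one-point compactification\<close>

text \<open>For \<open>|z| > 1\<close> a point is an orbit of the \<open>n\<close>-th roots of unity. The orbits at \<open>|z| = 1\<close> are
  the whole circles, which form the attached projective line. The added point is \<open>None\<close>.\<close>

definition lebrun_orbit :: "nat \<Rightarrow> C2 \<Rightarrow> C2 set" where
  "lebrun_orbit n z = {cscale c z | c. cmod c = 1 \<and> (norm z = 1 \<or> c ^ n = 1)}"

type_synonym point = "C2 set option"

definition end_chart :: "nat \<Rightarrow> (C2, point) orbichart" where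
  "end_chart n = \<lparr> cdom = {z. norm z > 1}, cmap = (\<lambda>z. Some (lebrun_orbit n z)) \<rparr>"

text \<open>Charts around the projective line: \<open>p = (1, \<zeta>)\<close> or \<open>(\<zeta>, 1)\<close> is a point of
  the line in an affine coordinate, and \<open>w\<close> is the fibre coordinate with respect to the unitary
  trivialization given by \<open>p / |p|\<close>; its modulus is the radial coordinate \<open>sqrt (r\<^sup>2 - 1)\<close> and its
  argument is \<open>n\<close> times the angle on the Hopf circle. Thus \<open>(\<zeta>, w)\<close> is sent to the orbit of
  \<open>r c p / |p|\<close> with \<open>r = sqrt (1 + |w|\<^sup>2)\<close> and \<open>c ^ n = w / |w|\<close>; for \<open>w = 0\<close>
  it is sent to the whole circle through \<open>p / |p|\<close>.\<close>

definition tube_point :: "nat \<Rightarrow> C2 \<Rightarrow> complex \<Rightarrow> point" where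
  "tube_point n p w =
     Some {(sqrt (1 + (cmod w)\<^sup>2) / norm p) *\<^sub>R cscale c p | c.
             cmod c = 1 \<and> of_real (cmod w) * c ^ n = w}"

definition tube_chart1 :: "nat \<Rightarrow> (C2, point) orbichart" where
  "tube_chart1 n = \<lparr> cdom = UNIV, cmap = (\<lambda>x. tube_point n (1, fst x) (snd x)) \<rparr>"

definition tube_chart2 :: "nat \<Rightarrow> (C2, point) orbichart" where
  "tube_chart2 n = \<lparr> cdom = UNIV, cmap = (\<lambda>x. tube_point n (fst x, 1) (snd x)) \<rparr>"

text \<open>The orbifold chart at the added point uses the inverted coordinate \<open>y = z / |z|\<^sup>2\<close>; the
  \<open>n\<close>-th roots of unity act freely on \<open>y \<noteq> 0\<close>.\<close>

definition infinity_chart :: "nat \<Rightarrow> (C2, point) orbichart" where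
  "infinity_chart n = \<lparr> cdom = ball 0 1,
     cmap = (\<lambda>y. if y = 0 then None else Some (lebrun_orbit n (y /\<^sub>R (norm y)\<^sup>2))) \<rparr>"

definition X_atlas :: "nat \<Rightarrow> (C2, point) orbichart set" where
  "X_atlas n = {end_chart n, tube_chart1 n, tube_chart2 n}"

definition Xhat_atlas :: "nat \<Rightarrow> (C2, point) orbichart set" where
  "Xhat_atlas n = insert (infinity_chart n) (X_atlas n)"

text \<open>LeBrun's metric is the smooth metric on all of \<open>\<O>(-n)\<close> given by the explicit formula outside
  the projective line. That set is dense, so the metric is unique on the chart domains.\<close>

definition lebrun_metric :: "nat \<Rightarrow> (C2, point) orbitensor \<Rightarrow> bool" where
  "lebrun_metric n g \<longleftrightarrow>
     orbifold_metric (X_atlas n) g \<and>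
     (\<forall>z\<in>cdom (end_chart n). g (end_chart n) z = lebrun_tensor n z)"

text \<open>In the decay condition, \<open>|z|\<close> is the radial coordinate \<open>r\<close>.\<close>

definition orbifold_conformal_compactification ::
  "nat \<Rightarrow> (C2, point) orbitensor \<Rightarrow> (point \<Rightarrow> real) \<Rightarrow> (C2, point) orbitensor \<Rightarrow> bool" where
  "orbifold_conformal_compactification n g u ghat \<longleftrightarrow>
     orbifold_smooth (X_atlas n) u \<and>
     (\<forall>C\<in>X_atlas n. \<forall>x\<in>cdom C. u (cmap C x) > 0) \<and>
     (\<lambda>z. u (Some (lebrun_orbit n z))) \<in> O[at_infinity](\<lambda>z. 1 / (norm z)\<^sup>2) \<and>
     orbifold_metric (Xhat_atlas n) ghat \<and>
     (\<forall>C\<in>X_atlas n. \<forall>x\<in>cdom C. \<forall>v w. ghat C x v w = (u (cmap C x))\<^sup>2 * g C x v w)"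

section \<open>The action of SU(2)\<close>

definition SU2 :: "(complex^2^2) set" where
  "SU2 = {A. A ** (\<chi> i j. cnj (A $ j $ i)) = mat 1 \<and> det A = 1}"

definition mat_act :: "complex^2^2 \<Rightarrow> C2 \<Rightarrow> C2" where
  "mat_act A z = (A $ 1 $ 1 * fst z + A $ 1 $ 2 * snd z, A $ 2 $ 1 * fst z + A $ 2 $ 2 * snd z)"

definition point_act :: "complex^2^2 \<Rightarrow> point \<Rightarrow> point" where
  "point_act A = map_option (\<lambda>orb. mat_act A ` orb)"

definition SU2_invariant :: "nat \<Rightarrow> (C2, point) orbitensor \<Rightarrow> bool" where
  "SU2_invariant n h \<longleftrightarrow> (\<forall>A\<in>SU2. preserves_metric (Xhat_atlas n) (point_act A) h)"

end

theory Submission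
  imports Defs "HOL-Real_Asymp.Real_Asymp"
begin

text \<open>An \<open>SU(2)\<close>-invariant solution is \<open>v\<^sup>2 g\<close> with \<open>v\<close> a function of \<open>s = r\<^sup>2\<close>. Since \<open>g\<close> is
  scalar-flat, constant scalar curvature \<open>c\<close> means \<open>(P v')' = - (c/24) s v\<^sup>3\<close> with
  \<open>P = (s - 1) (s + m)\<close> and \<open>m = n - 1\<close>. Smoothness at the projective line and at the added point
  gives \<open>P v' = O(sqrt (s - 1))\<close> as \<open>s \<rightarrow> 1\<close>, and \<open>v = O(1/s)\<close>, \<open>P v' = O(1)\<close> as \<open>s \<rightarrow> \<infinity>\<close>.
  If \<open>c \<le> 0\<close> then \<open>v\<close> is nondecreasing and cannot decay. If \<open>c > 0\<close> then \<open>v\<close> is decreasing. Compare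
  with the Ricci-flat Eguchi-Hanson metric: up to the conformal factor it has the same \<open>P\<close>, and in its
  equation \<open>s\<close> is replaced by \<open>P'\<close>. The Pohozaev function \<open>E\<close> built from \<open>a = (P P') powr (- 1/3)\<close> is
  then strictly increasing for \<open>m \<ge> 1\<close>, because \<open>s / P'\<close> is nondecreasing and
  \<open>(P a')' = a (m + 1)\<^sup>4 / (9 P P'\<^sup>2) > 0\<close>. But \<open>E\<close> tends to \<open>0\<close> at both ends.\<close>

section \<open>Nonexistence for the radial equation\<close>

lemma tendsto_0_of_bigo:
  fixes f g :: "'a \<Rightarrow> real"
  assumes "f \<in> O[F](g)" "(g \<longlongrightarrow> 0) F"
  shows "(f \<longlongrightarrow> 0) F"
proof -
  obtain c where c: "eventually (\<lambda>x. norm (f x) \<le> c * norm (g x)) F"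
    using assms(1) by (auto simp: bigo_def)
  have "((\<lambda>x. c * norm (g x)) \<longlongrightarrow> c * norm (0::real)) F"
    by (intro tendsto_intros assms)
  then show ?thesis
    using c by (auto intro: Lim_null_comparison)
qed

text \<open>Here \<open>y\<close> is the flux \<open>P v'\<close> and \<open>\<kappa>\<close> is
  \<open>c / 24\<close>. The sign of \<open>\<kappa>\<close> decides whether \<open>y\<close> rises
  or falls, and the limit \<open>0\<close> of \<open>y\<close> at \<open>1\<close> then fixes the
  sign of \<open>v'\<close>. For \<open>\<kappa> > 0\<close> the four bounds together make every
  term of \<open>E\<close> vanish at both ends.\<close>

lemma pohozaev_obstruction:
  fixes v y :: "real \<Rightarrow> real" and m \<kappa> :: real
  assumes m: "m \<ge> 1"
    and vpos: "\<And>s. s > 1 \<Longrightarrow> v s > 0"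
    and v': "\<And>s. s > 1 \<Longrightarrow> (v has_real_derivative y s / ((s - 1) * (s + m))) (at s)"
    and y': "\<And>s. s > 1 \<Longrightarrow> (y has_real_derivative - \<kappa> * s * v s ^ 3) (at s)"
    and v_near: "v \<in> O[at_right 1](\<lambda>_. 1)"
    and y_near: "y \<in> O[at_right 1](\<lambda>s. sqrt (s - 1))"
    and v_far: "v \<in> O[at_top](\<lambda>s. 1 / s)"
    and y_far: "y \<in> O[at_top](\<lambda>_. 1)"
  shows False
proof -
  have y0: "(y \<longlongrightarrow> 0) (at_right 1)"
    by (rule tendsto_0_of_bigo[OF y_near]) real_asymp
  have v_inf: "(v \<longlongrightarrow> 0) at_top"
    by (rule tendsto_0_of_bigo[OF v_far]) real_asymp
  have P_pos: "(s - 1) * (s + m) > 0" if "s > 1" for s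
    using that m by simp
  show False
  proof (cases "\<kappa> \<le> 0")

    \<comment> \<open>Nonpositive curvature constant\<close>
    case True
    have y_mono: "y s \<le> y t" if "1 < s" "s \<le> t" for s t
    proof (rule DERIV_nonneg_imp_nondecreasing[OF that(2)])
      fix x assume "s \<le> x" "x \<le> t"
      then have x: "x > 1" using that by simp
      have "0 \<le> - \<kappa> * x * v x ^ 3"
        using True x vpos[OF x] by (simp add: mult_nonpos_nonneg)
      then show "\<exists>d. DERIV y x :> d \<and> 0 \<le> d" using y'[OF x] by blast
    qed
    have y_nonneg: "y t \<ge> 0" if t: "t > 1" for t
    proof (rule tendsto_upperbound[OF y0])
      show "\<forall>\<^sub>F s in at_right 1. y s \<le> y t"
        using eventually_at_right_real[OF t] by eventually_elim (auto intro: y_mono)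
    qed simp
    have v_mono: "v 2 \<le> v t" if "2 \<le> t" for t
    proof (rule DERIV_nonneg_imp_nondecreasing[OF that])
      fix x assume "2 \<le> x" "x \<le> t"
      then have x: "x > 1" by simp
      show "\<exists>d. DERIV v x :> d \<and> 0 \<le> d"
        using v'[OF x] y_nonneg[OF x] P_pos[OF x] by (meson divide_nonneg_pos)
    qed
    have "v 2 \<le> 0"
    proof (rule tendsto_lowerbound[OF v_inf])
      show "\<forall>\<^sub>F t in at_top. v 2 \<le> v t"
        using eventually_ge_at_top[of 2] by eventually_elim (rule v_mono)
    qed simp
    then show False using vpos[of 2] by simp
  next

    \<comment> \<open>Positive curvature constant\<close>
    case False
    then have \<kappa>: "\<kappa> > 0" by simp
    have y_mono: "y t < y s" if "1 < s" "s < t" for s t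
    proof (rule DERIV_neg_imp_decreasing[OF that(2)])
      fix x assume "s \<le> x" "x \<le> t"
      then have x: "x > 1" using that by simp
      have "- \<kappa> * x * v x ^ 3 < 0"
        using \<kappa> x vpos[OF x] by simp
      then show "\<exists>d. DERIV y x :> d \<and> d < 0" using y'[OF x] by blast
    qed
    have y_nonpos: "y t \<le> 0" if t: "t > 1" for t
    proof (rule tendsto_lowerbound[OF y0])
      show "\<forall>\<^sub>F s in at_right 1. y t \<le> y s"
        using eventually_at_right_real[OF t] by eventually_elim (auto intro: less_imp_le[OF y_mono])
    qed simp
    have y_neg: "y t < 0" if t: "t > 1" for t
      using y_mono[of "(1 + t) / 2" t] y_nonpos[of "(1 + t) / 2"] t by simp
    txt \<open>The term with \<open>w = P a'\<close> is chosen so that the terms \<open>y\<^sup>2\<close> and \<open>v\<^sup>3 y\<close> cancel in \<open>E'\<close>.\<close>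
    define P where "P = (\<lambda>s::real. (s - 1) * (s + m))"
    define Q where "Q = (\<lambda>s::real. 2 * s + m - 1)"
    \<comment> \<open>With \<open>w = P a'\<close>, the factor of \<open>v ^ 4\<close> in
      \<open>E'\<close> is \<open>\<kappa> / 2\<close> times \<open>3 s w + a (s P)'\<close>. If
      \<open>s\<close> is replaced by \<open>P'\<close>, this vanishes exactly when \<open>a\<close>
      is a multiple of \<open>(P P') powr (- 1/3)\<close>; hence the exponent.\<close>
    define a where "a = (\<lambda>s. (P s * Q s) powr (- 1/3))"
    define w where "w = (\<lambda>s. - (a s / 3 * (Q s + 2 * P s / Q s)))"
    define E where "E = (\<lambda>s. a s * (y s)\<^sup>2 - w s * v s * y s + \<kappa> / 2 * (s * P s * a s) * v s ^ 4)"
    have pos: "P s > 0" "Q s > 0" "a s > 0" if "s > 1" for s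
      using that m by (auto simp: P_def Q_def a_def)
    have P': "(P has_real_derivative Q s) (at s)" for s
      unfolding P_def Q_def by (auto intro!: derivative_eq_intros)
    have Q': "(Q has_real_derivative 2) (at s)" for s
      unfolding Q_def by (auto intro!: derivative_eq_intros)
    \<comment> \<open>The discriminant of the quadratic \<open>P\<close>: the squared gap between
      its roots \<open>1\<close> and \<open>- m\<close>. It is constant, and its square is the
      numerator of \<open>w'\<close>, which makes \<open>w'\<close> positive.\<close>
    have disc: "(Q s)\<^sup>2 - 4 * P s = (m + 1)\<^sup>2" for s
      unfolding P_def Q_def by (simp add: power2_eq_square algebra_simps)
    have a': "(a has_real_derivative w s / P s) (at s)" if s: "s > 1" for s
    proof -
      note p = pos[OF s]
      have "(a has_real_derivative
          (-1/3) * (P s * Q s) powr (-1/3 - 1) * (Q s * Q s + P s * 2)) (at s)"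
        unfolding a_def using p
        by (auto intro!: derivative_eq_intros P' Q' simp: field_simps)
      moreover have "(P s * Q s) powr (-1/3 - 1) = a s / (P s * Q s)"
        unfolding a_def using p by (subst powr_diff) simp
      moreover have "(-1/3) * (a s / (P s * Q s)) * (Q s * Q s + P s * 2) = w s / P s"
        unfolding w_def using p by (simp add: field_simps)
      ultimately show ?thesis by (simp only:)
    qed
    have w': "(w has_real_derivative a s * (m + 1) ^ 4 / (9 * P s * (Q s)\<^sup>2)) (at s)" if s: "s > 1" for s
    proof -
      note p = pos[OF s]
      have "((\<lambda>s. Q s + 2 * P s / Q s) has_real_derivative 4 - 4 * P s / (Q s)\<^sup>2) (at s)"
        using p by (auto intro!: derivative_eq_intros P' Q' simp: field_simps power2_eq_square)
      from DERIV_minus[OF DERIV_mult[OF DERIV_cdivide[OF a'[OF s], of 3] this]]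
      have "(w has_real_derivative - (w s / P s / 3 * (Q s + 2 * P s / Q s)
          + a s / 3 * (4 - 4 * P s / (Q s)\<^sup>2))) (at s)"
        unfolding w_def by (simp add: mult.commute)
      moreover have "- (w s / P s / 3 * (Q s + 2 * P s / Q s) + a s / 3 * (4 - 4 * P s / (Q s)\<^sup>2))
          = a s * ((Q s)\<^sup>2 - 4 * P s)\<^sup>2 / (9 * P s * (Q s)\<^sup>2)"
        unfolding w_def using p by (simp add: divide_simps) algebra
      ultimately show ?thesis unfolding disc by simp
    qed
    \<comment> \<open>Only two terms survive. The first is positive since \<open>y < 0 < v\<close>;
      it gives strict growth even for \<open>m = 1\<close>, where the second vanishes.\<close>
    define E' where "E' = (\<lambda>s. - (a s * (m + 1) ^ 4 / (9 * P s * (Q s)\<^sup>2)) * v s * y s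
        + \<kappa> * a s * P s * (m - 1) / (2 * Q s) * v s ^ 4)"
    have E_deriv: "(E has_real_derivative E' s) (at s)" if s: "s > 1" for s
    proof -
      note p = pos[OF s]
      have vd: "(v has_real_derivative y s / P s) (at s)" using v'[OF s] by (simp add: P_def)
      have *: "(E has_real_derivative
          (w s / P s * (y s)\<^sup>2 + a s * (2 * y s * (- \<kappa> * s * v s ^ 3)))
          - (a s * (m + 1) ^ 4 / (9 * P s * (Q s)\<^sup>2) * v s * y s
             + w s * (y s / P s) * y s + w s * v s * (- \<kappa> * s * v s ^ 3))
          + \<kappa> / 2 * ((P s * a s + s * Q s * a s + s * P s * (w s / P s)) * v s ^ 4
             + s * P s * a s * (4 * v s ^ 3 * (y s / P s)))) (at s)"
        unfolding E_def
        by (rule DERIV_cong[OF DERIV_add[OF DERIV_diff[OF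
              DERIV_mult[OF a'[OF s] DERIV_power[OF y'[OF s], of 2]]
              DERIV_mult[OF DERIV_mult[OF w'[OF s] vd] y'[OF s]]]
              DERIV_mult[OF DERIV_cmult[OF DERIV_mult[OF DERIV_mult[OF DERIV_ident P'] a'[OF s]]] DERIV_power[OF vd, of 4]]]])
           (simp add: algebra_simps)
      \<comment> \<open>Inserting \<open>w\<close> leaves only the deviation of \<open>2 s\<close>
        from \<open>P'\<close>, that is \<open>Q s - 2 * s = m - 1\<close>, which is zero in the
        Eguchi-Hanson case \<open>m = 1\<close>.\<close>
      have **: "\<kappa> * s * w s + \<kappa> / 2 * (P s * a s + s * Q s * a s + s * w s) = \<kappa> * a s * P s * (m - 1) / (2 * Q s)"
      proof -
        have "\<kappa> * s * w s + \<kappa> / 2 * (P s * a s + s * Q s * a s + s * w s) = \<kappa> * a s * P s * (Q s - 2 * s) / (2 * Q s)"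
          unfolding w_def using p by (simp add: divide_simps) algebra
        then show ?thesis by (simp add: Q_def)
      qed
      show ?thesis
        using * unfolding E'_def **[symmetric]
        apply (rule back_subst[of "\<lambda>x. (E has_real_derivative x) (at s)"])
        using p by (simp add: field_simps power2_eq_square power4_eq_xxxx power3_eq_cube)
    qed
    have E'_pos: "E' s > 0" if s: "s > 1" for s
    proof -
      note p = pos[OF s]
      have "- (a s * (m + 1) ^ 4 / (9 * P s * (Q s)\<^sup>2)) * v s * y s > 0"
        using p vpos[OF s] y_neg[OF s] m by (simp add: mult_pos_neg divide_neg_pos)
      moreover have "\<kappa> * a s * P s * (m - 1) / (2 * Q s) * v s ^ 4 \<ge> 0"
        using p vpos[OF s] m \<kappa> by simp
      ultimately show ?thesis unfolding E'_def by linarith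
    qed
    have E_mono: "E s < E t" if "1 < s" "s < t" for s t
    proof (rule DERIV_pos_imp_increasing[OF that(2)])
      fix x assume "s \<le> x" "x \<le> t"
      then have x: "x > 1" using that by simp
      show "\<exists>d. DERIV E x :> d \<and> d > 0" using E_deriv[OF x] E'_pos[OF x] by blast
    qed
    \<comment> \<open>Put \<open>x = s - 1\<close>. Since \<open>P\<close> has a simple zero at
      \<open>1\<close>, both \<open>a\<close> and \<open>w\<close> grow like
      \<open>x powr (- 1/3)\<close>, so the three terms are of order \<open>x powr (2/3)\<close>,
      \<open>x powr (1/6)\<close> and \<open>x powr (2/3)\<close> at most.\<close>
    have E_near: "(E \<longlongrightarrow> 0) (at_right 1)"
    proof -
      have 1: "((\<lambda>s. a s * (y s)\<^sup>2) \<longlongrightarrow> 0) (at_right 1)"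
      proof (rule tendsto_0_of_bigo)
        show "(\<lambda>s. a s * (y s)\<^sup>2) \<in> O[at_right 1](\<lambda>s. a s * (sqrt (s - 1))\<^sup>2)"
          by (intro landau_o.big.mult landau_o.big_power y_near landau_o.big_refl)
        show "((\<lambda>s. a s * (sqrt (s - 1))\<^sup>2) \<longlongrightarrow> 0) (at_right 1)"
          unfolding a_def P_def Q_def using m by real_asymp
      qed
      have 2: "((\<lambda>s. w s * v s * y s) \<longlongrightarrow> 0) (at_right 1)"
      proof (rule tendsto_0_of_bigo)
        show "(\<lambda>s. w s * v s * y s) \<in> O[at_right 1](\<lambda>s. w s * 1 * sqrt (s - 1))"
          by (intro landau_o.big.mult y_near v_near landau_o.big_refl)
        show "((\<lambda>s. w s * 1 * sqrt (s - 1)) \<longlongrightarrow> 0) (at_right 1)"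
          unfolding w_def a_def P_def Q_def using m by real_asymp
      qed
      have 3: "((\<lambda>s. \<kappa> / 2 * (s * P s * a s) * v s ^ 4) \<longlongrightarrow> 0) (at_right 1)"
      proof (rule tendsto_0_of_bigo)
        show "(\<lambda>s. \<kappa> / 2 * (s * P s * a s) * v s ^ 4) \<in> O[at_right 1](\<lambda>s. \<kappa> / 2 * (s * P s * a s) * 1 ^ 4)"
          by (intro landau_o.big.mult landau_o.big_power v_near landau_o.big_refl)
        show "((\<lambda>s. \<kappa> / 2 * (s * P s * a s) * 1 ^ 4) \<longlongrightarrow> 0) (at_right 1)"
          unfolding a_def P_def Q_def using m by real_asymp
      qed
      show ?thesis unfolding E_def using tendsto_add[OF tendsto_diff[OF 1 2] 3] by simp
    qed
    \<comment> \<open>\<open>P Q\<close> grows like \<open>2 s^3\<close>, so \<open>a\<close> decays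
      like \<open>1 / s\<close> and \<open>w\<close> stays bounded; the three terms are of order
      \<open>1 / s\<close>, \<open>1 / s\<close> and \<open>1 / s^2\<close> at most.\<close>
    have E_far: "(E \<longlongrightarrow> 0) at_top"
    proof -
      have 1: "((\<lambda>s. a s * (y s)\<^sup>2) \<longlongrightarrow> 0) at_top"
      proof (rule tendsto_0_of_bigo)
        show "(\<lambda>s. a s * (y s)\<^sup>2) \<in> O[at_top](\<lambda>s. a s * 1\<^sup>2)"
          by (intro landau_o.big.mult landau_o.big_power y_far landau_o.big_refl)
        show "((\<lambda>s. a s * 1\<^sup>2) \<longlongrightarrow> 0) at_top"
          unfolding a_def P_def Q_def using m by real_asymp
      qed
      have 2: "((\<lambda>s. w s * v s * y s) \<longlongrightarrow> 0) at_top"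
      proof (rule tendsto_0_of_bigo)
        show "(\<lambda>s. w s * v s * y s) \<in> O[at_top](\<lambda>s. w s * (1 / s) * 1)"
          by (intro landau_o.big.mult y_far v_far landau_o.big_refl)
        show "((\<lambda>s. w s * (1 / s) * 1) \<longlongrightarrow> 0) at_top"
          unfolding w_def a_def P_def Q_def using m by real_asymp
      qed
      have 3: "((\<lambda>s. \<kappa> / 2 * (s * P s * a s) * v s ^ 4) \<longlongrightarrow> 0) at_top"
      proof (rule tendsto_0_of_bigo)
        show "(\<lambda>s. \<kappa> / 2 * (s * P s * a s) * v s ^ 4) \<in> O[at_top](\<lambda>s. \<kappa> / 2 * (s * P s * a s) * (1 / s) ^ 4)"
          by (intro landau_o.big.mult landau_o.big_power v_far landau_o.big_refl)
        show "((\<lambda>s. \<kappa> / 2 * (s * P s * a s) * (1 / s) ^ 4) \<longlongrightarrow> 0) at_top"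
          unfolding a_def P_def Q_def using m by real_asymp
      qed
      show ?thesis unfolding E_def using tendsto_add[OF tendsto_diff[OF 1 2] 3] by simp
    qed
    have "0 \<le> E 2"
    proof (rule tendsto_upperbound[OF E_near])
      show "\<forall>\<^sub>F s in at_right 1. E s \<le> E 2"
        using eventually_at_right_real[of 1 2] by (auto elim!: eventually_mono intro: less_imp_le[OF E_mono])
    qed simp
    moreover have "E 3 \<le> 0"
    proof (rule tendsto_lowerbound[OF E_far])
      show "\<forall>\<^sub>F s in at_top. E 3 \<le> E s"
        using eventually_gt_at_top[of 3] by eventually_elim (auto intro: less_imp_le[OF E_mono])
    qed simp
    ultimately show False using E_mono[of 2 3] by simp
  qed
qed

section \<open>Scalar curvature of \<open>U(2)\<close>-invariant metrics\<close>

text \<open>The arguments \<open>A, B, C\<close> are the values at \<open>s = z \<bullet> z\<close> of functions of \<open>s\<close>, and \<open>A1, A2, \<dots>\<close>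
  are the values of their derivatives there. Then \<open>radial_form_deriv\<close> and \<open>radial_form_deriv2\<close> are the first
  derivative of \<open>radial_form\<close> in direction \<open>p\<close> and its derivative in direction \<open>q\<close>.\<close>

definition radial_form :: "real \<Rightarrow> real \<Rightarrow> real \<Rightarrow> C2 \<Rightarrow> C2 \<Rightarrow> C2 \<Rightarrow> real" where
  "radial_form A B C z v w = A * (v \<bullet> w) + B * ((z \<bullet> v) * (z \<bullet> w)) + C * ((cscale \<i> z \<bullet> v) * (cscale \<i> z \<bullet> w))"

definition radial_form_deriv :: "real \<Rightarrow> real \<Rightarrow> real \<Rightarrow> real \<Rightarrow> real \<Rightarrow> C2 \<Rightarrow> C2 \<Rightarrow> C2 \<Rightarrow> C2 \<Rightarrow> real" where
  "radial_form_deriv A1 B B1 C C1 z p v w = 2 * (z \<bullet> p) * radial_form A1 B1 C1 z v w +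
     B * ((p \<bullet> v) * (z \<bullet> w) + (z \<bullet> v) * (p \<bullet> w)) +
     C * ((cscale \<i> p \<bullet> v) * (cscale \<i> z \<bullet> w) + (cscale \<i> z \<bullet> v) * (cscale \<i> p \<bullet> w))"

definition radial_form_deriv2 :: "real \<Rightarrow> real \<Rightarrow> real \<Rightarrow> real \<Rightarrow> real \<Rightarrow> real \<Rightarrow> real \<Rightarrow> real \<Rightarrow> C2 \<Rightarrow> C2 \<Rightarrow> C2 \<Rightarrow> C2 \<Rightarrow> C2 \<Rightarrow> real" where
  "radial_form_deriv2 A1 A2 B B1 B2 C C1 C2 z q p v w =
     2 * (q \<bullet> p) * radial_form A1 B1 C1 z v w + 2 * (z \<bullet> p) * radial_form_deriv A2 B1 B2 C1 C2 z q v w +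
     2 * (z \<bullet> q) * (B1 * ((p \<bullet> v) * (z \<bullet> w) + (z \<bullet> v) * (p \<bullet> w)) +
       C1 * ((cscale \<i> p \<bullet> v) * (cscale \<i> z \<bullet> w) + (cscale \<i> z \<bullet> v) * (cscale \<i> p \<bullet> w))) +
     B * ((p \<bullet> v) * (q \<bullet> w) + (q \<bullet> v) * (p \<bullet> w)) +
     C * ((cscale \<i> p \<bullet> v) * (cscale \<i> q \<bullet> w) + (cscale \<i> q \<bullet> v) * (cscale \<i> p \<bullet> w))"

section \<open>Curvature on the axis from the jets of the coefficients\<close>

lemma Basis_C2: "(Basis :: C2 set) = {(1, 0), (\<i>, 0), (0, 1), (0, \<i>)}"
  by (auto simp: Basis_prod_def Basis_complex_def)

lemma sum_Basis_C2: "(\<Sum>i\<in>(Basis :: C2 set). f i) = f (1, 0) + f (\<i>, 0) + f (0, 1) + f (0, \<i>)"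
  by (simp add: Basis_C2 algebra_simps)

text \<open>On the axis \<open>z = (r, 0)\<close> the metric and its inverse are diagonal, so the curvature of
  \<open>radial_form A B C\<close> with inverse \<open>radial_form a b c\<close> is computed from the jets of the coefficients:
  \<open>christoffel_axis\<close> and \<open>christoffel_axis_deriv p\<close> are the Christoffel symbols and their derivatives in direction \<open>p\<close>.\<close>

context
  fixes r A1 A2 B B1 B2 C C1 C2 a a1 b b1 c c1 :: real
begin

definition christoffel_axis :: "C2 \<Rightarrow> C2 \<Rightarrow> C2 \<Rightarrow> real" where
  "christoffel_axis k i j = (1/2) * (\<Sum>l\<in>Basis. radial_form a b c (of_real r, 0) k l *
     (radial_form_deriv A1 B B1 C C1 (of_real r, 0) i j l + radial_form_deriv A1 B B1 C C1 (of_real r, 0) j i l - radial_form_deriv A1 B B1 C C1 (of_real r, 0) l i j))"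

definition christoffel_axis_deriv :: "C2 \<Rightarrow> C2 \<Rightarrow> C2 \<Rightarrow> C2 \<Rightarrow> real" where
  "christoffel_axis_deriv p k i j = (1/2) * (\<Sum>l\<in>Basis.
     radial_form_deriv a1 b b1 c c1 (of_real r, 0) p k l *
     (radial_form_deriv A1 B B1 C C1 (of_real r, 0) i j l + radial_form_deriv A1 B B1 C C1 (of_real r, 0) j i l - radial_form_deriv A1 B B1 C C1 (of_real r, 0) l i j) +
     radial_form a b c (of_real r, 0) k l *
     (radial_form_deriv2 A1 A2 B B1 B2 C C1 C2 (of_real r, 0) p i j l + radial_form_deriv2 A1 A2 B B1 B2 C C1 C2 (of_real r, 0) p j i l
       - radial_form_deriv2 A1 A2 B B1 B2 C C1 C2 (of_real r, 0) p l i j))"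

lemmas radial_form_simps = radial_form_def radial_form_deriv_def radial_form_deriv2_def cscale_def inner_prod_def inner_complex_def

text \<open>The full table of 64 symbols, zeros included, so that the quadratic part of the
  curvature can be evaluated by rewriting.\<close>

lemma christoffel_axis_values:
  "christoffel_axis (1, 0) (1, 0) (1, 0) = r * (a + b * r\<^sup>2) * (A1 + B + B1 * r\<^sup>2)"
  "christoffel_axis (1, 0) (1, 0) (\<i>, 0) = 0"
  "christoffel_axis (1, 0) (1, 0) (0, 1) = 0"
  "christoffel_axis (1, 0) (1, 0) (0, \<i>) = 0"
  "christoffel_axis (1, 0) (\<i>, 0) (1, 0) = 0"
  "christoffel_axis (1, 0) (\<i>, 0) (\<i>, 0) = r * (a + b * r\<^sup>2) * (B - A1 - 2 * C - C1 * r\<^sup>2)"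
  "christoffel_axis (1, 0) (\<i>, 0) (0, 1) = 0"
  "christoffel_axis (1, 0) (\<i>, 0) (0, \<i>) = 0"
  "christoffel_axis (1, 0) (0, 1) (1, 0) = 0"
  "christoffel_axis (1, 0) (0, 1) (\<i>, 0) = 0"
  "christoffel_axis (1, 0) (0, 1) (0, 1) = r * (a + b * r\<^sup>2) * (B - A1)"
  "christoffel_axis (1, 0) (0, 1) (0, \<i>) = 0"
  "christoffel_axis (1, 0) (0, \<i>) (1, 0) = 0"
  "christoffel_axis (1, 0) (0, \<i>) (\<i>, 0) = 0"
  "christoffel_axis (1, 0) (0, \<i>) (0, 1) = 0"
  "christoffel_axis (1, 0) (0, \<i>) (0, \<i>) = r * (a + b * r\<^sup>2) * (B - A1)"
  "christoffel_axis (\<i>, 0) (1, 0) (1, 0) = 0"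
  "christoffel_axis (\<i>, 0) (1, 0) (\<i>, 0) = r * (a + c * r\<^sup>2) * (A1 + C + C1 * r\<^sup>2)"
  "christoffel_axis (\<i>, 0) (1, 0) (0, 1) = 0"
  "christoffel_axis (\<i>, 0) (1, 0) (0, \<i>) = 0"
  "christoffel_axis (\<i>, 0) (\<i>, 0) (1, 0) = r * (a + c * r\<^sup>2) * (A1 + C + C1 * r\<^sup>2)"
  "christoffel_axis (\<i>, 0) (\<i>, 0) (\<i>, 0) = 0"
  "christoffel_axis (\<i>, 0) (\<i>, 0) (0, 1) = 0"
  "christoffel_axis (\<i>, 0) (\<i>, 0) (0, \<i>) = 0"
  "christoffel_axis (\<i>, 0) (0, 1) (1, 0) = 0"
  "christoffel_axis (\<i>, 0) (0, 1) (\<i>, 0) = 0"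
  "christoffel_axis (\<i>, 0) (0, 1) (0, 1) = 0"
  "christoffel_axis (\<i>, 0) (0, 1) (0, \<i>) = 0"
  "christoffel_axis (\<i>, 0) (0, \<i>) (1, 0) = 0"
  "christoffel_axis (\<i>, 0) (0, \<i>) (\<i>, 0) = 0"
  "christoffel_axis (\<i>, 0) (0, \<i>) (0, 1) = 0"
  "christoffel_axis (\<i>, 0) (0, \<i>) (0, \<i>) = 0"
  "christoffel_axis (0, 1) (1, 0) (1, 0) = 0"
  "christoffel_axis (0, 1) (1, 0) (\<i>, 0) = 0"
  "christoffel_axis (0, 1) (1, 0) (0, 1) = r * a * A1"
  "christoffel_axis (0, 1) (1, 0) (0, \<i>) = 0"
  "christoffel_axis (0, 1) (\<i>, 0) (1, 0) = 0"
  "christoffel_axis (0, 1) (\<i>, 0) (\<i>, 0) = 0"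
  "christoffel_axis (0, 1) (\<i>, 0) (0, 1) = 0"
  "christoffel_axis (0, 1) (\<i>, 0) (0, \<i>) = - r * a * C"
  "christoffel_axis (0, 1) (0, 1) (1, 0) = r * a * A1"
  "christoffel_axis (0, 1) (0, 1) (\<i>, 0) = 0"
  "christoffel_axis (0, 1) (0, 1) (0, 1) = 0"
  "christoffel_axis (0, 1) (0, 1) (0, \<i>) = 0"
  "christoffel_axis (0, 1) (0, \<i>) (1, 0) = 0"
  "christoffel_axis (0, 1) (0, \<i>) (\<i>, 0) = - r * a * C"
  "christoffel_axis (0, 1) (0, \<i>) (0, 1) = 0"
  "christoffel_axis (0, 1) (0, \<i>) (0, \<i>) = 0"
  "christoffel_axis (0, \<i>) (1, 0) (1, 0) = 0"
  "christoffel_axis (0, \<i>) (1, 0) (\<i>, 0) = 0"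
  "christoffel_axis (0, \<i>) (1, 0) (0, 1) = 0"
  "christoffel_axis (0, \<i>) (1, 0) (0, \<i>) = r * a * A1"
  "christoffel_axis (0, \<i>) (\<i>, 0) (1, 0) = 0"
  "christoffel_axis (0, \<i>) (\<i>, 0) (\<i>, 0) = 0"
  "christoffel_axis (0, \<i>) (\<i>, 0) (0, 1) = r * a * C"
  "christoffel_axis (0, \<i>) (\<i>, 0) (0, \<i>) = 0"
  "christoffel_axis (0, \<i>) (0, 1) (1, 0) = 0"
  "christoffel_axis (0, \<i>) (0, 1) (\<i>, 0) = r * a * C"
  "christoffel_axis (0, \<i>) (0, 1) (0, 1) = 0"
  "christoffel_axis (0, \<i>) (0, 1) (0, \<i>) = 0"
  "christoffel_axis (0, \<i>) (0, \<i>) (1, 0) = r * a * A1"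
  "christoffel_axis (0, \<i>) (0, \<i>) (\<i>, 0) = 0"
  "christoffel_axis (0, \<i>) (0, \<i>) (0, 1) = 0"
  "christoffel_axis (0, \<i>) (0, \<i>) (0, \<i>) = 0"
  by (simp_all add: christoffel_axis_def sum_Basis_C2 radial_form_simps power2_eq_square algebra_simps)


text \<open>The inverse metric is diagonal on the axis, so only diagonal Ricci entries contribute to
  the scalar curvature. They involve these differences for the twelve ordered pairs of distinct
  basis vectors.\<close>

lemma christoffel_axis_deriv_values:
  "christoffel_axis_deriv (1, 0) (1, 0) (\<i>, 0) (\<i>, 0) - christoffel_axis_deriv (\<i>, 0) (1, 0) (1, 0) (\<i>, 0) = - 2 * A1 * a + B * a - 3 * C * a
      + r\<^sup>2 * (- 2 * A1 * a1 - 5 * A1 * b + A1 * c - 2 * A2 * a + 2 * B * a1 + 3 * B * b + B1 * a - 4 * C * a1 - 8 * C * b + C * c - 7 * C1 * a)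
      + r ^ 4 * (- 2 * A1 * b1 - 2 * A2 * b + 2 * B * b1 + B1 * b - 4 * C * b1 - 2 * C1 * a1 - 10 * C1 * b + C1 * c - 2 * C2 * a)
      + r ^ 6 * (- 2 * C1 * b1 - 2 * C2 * b)"
  "christoffel_axis_deriv (1, 0) (1, 0) (0, 1) (0, 1) - christoffel_axis_deriv (0, 1) (1, 0) (1, 0) (0, 1) = - 2 * A1 * a + B * a
      + r\<^sup>2 * (- 2 * A1 * a1 - 5 * A1 * b - 2 * A2 * a + 2 * B * a1 + 3 * B * b + B1 * a)
      + r ^ 4 * (- 2 * A1 * b1 - 2 * A2 * b + 2 * B * b1 + B1 * b)"
  "christoffel_axis_deriv (1, 0) (1, 0) (0, \<i>) (0, \<i>) - christoffel_axis_deriv (0, \<i>) (1, 0) (1, 0) (0, \<i>) = - 2 * A1 * a + B * a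
      + r\<^sup>2 * (- 2 * A1 * a1 - 5 * A1 * b - 2 * A2 * a + 2 * B * a1 + 3 * B * b + B1 * a)
      + r ^ 4 * (- 2 * A1 * b1 - 2 * A2 * b + 2 * B * b1 + B1 * b)"
  "christoffel_axis_deriv (\<i>, 0) (\<i>, 0) (1, 0) (1, 0) - christoffel_axis_deriv (1, 0) (\<i>, 0) (\<i>, 0) (1, 0) = - 2 * A1 * a + B * a - 3 * C * a
      + r\<^sup>2 * (- 2 * A1 * a1 + A1 * b - 5 * A1 * c - 2 * A2 * a + B * b + B1 * a - 2 * C * a1 - 5 * C * c - 7 * C1 * a)
      + r ^ 4 * (- 2 * A1 * c1 - 2 * A2 * c + B1 * b - 2 * C * c1 - 2 * C1 * a1 - 9 * C1 * c - 2 * C2 * a)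
      + r ^ 6 * (- 2 * C1 * c1 - 2 * C2 * c)"
  "christoffel_axis_deriv (\<i>, 0) (\<i>, 0) (0, 1) (0, 1) - christoffel_axis_deriv (0, 1) (\<i>, 0) (\<i>, 0) (0, 1) = - 2 * A1 * a + B * a
      + r\<^sup>2 * (- A1 * b - A1 * c + B * b - C * c - C1 * a)
      + r ^ 4 * (- C1 * c)"
  "christoffel_axis_deriv (\<i>, 0) (\<i>, 0) (0, \<i>) (0, \<i>) - christoffel_axis_deriv (0, \<i>) (\<i>, 0) (\<i>, 0) (0, \<i>) = - 2 * A1 * a + B * a
      + r\<^sup>2 * (- A1 * b - A1 * c + B * b - C * c - C1 * a)
      + r ^ 4 * (- C1 * c)"
  "christoffel_axis_deriv (0, 1) (0, 1) (1, 0) (1, 0) - christoffel_axis_deriv (1, 0) (0, 1) (0, 1) (1, 0) = - 2 * A1 * a + B * a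
      + r\<^sup>2 * (- 2 * A1 * a1 + A1 * b - 2 * A2 * a + B * b + B1 * a)
      + r ^ 4 * (B1 * b)"
  "christoffel_axis_deriv (0, 1) (0, 1) (\<i>, 0) (\<i>, 0) - christoffel_axis_deriv (\<i>, 0) (0, 1) (0, 1) (\<i>, 0) = - 2 * A1 * a + B * a
      + r\<^sup>2 * (- A1 * b + B * b - 2 * C * b - C1 * a)
      + r ^ 4 * (- C1 * b)"
  "christoffel_axis_deriv (0, 1) (0, 1) (0, \<i>) (0, \<i>) - christoffel_axis_deriv (0, \<i>) (0, 1) (0, 1) (0, \<i>) = - 2 * A1 * a + B * a - 3 * C * a
      + r\<^sup>2 * (- A1 * b + B * b)"
  "christoffel_axis_deriv (0, \<i>) (0, \<i>) (1, 0) (1, 0) - christoffel_axis_deriv (1, 0) (0, \<i>) (0, \<i>) (1, 0) = - 2 * A1 * a + B * a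
      + r\<^sup>2 * (- 2 * A1 * a1 + A1 * b - 2 * A2 * a + B * b + B1 * a)
      + r ^ 4 * (B1 * b)"
  "christoffel_axis_deriv (0, \<i>) (0, \<i>) (\<i>, 0) (\<i>, 0) - christoffel_axis_deriv (\<i>, 0) (0, \<i>) (0, \<i>) (\<i>, 0) = - 2 * A1 * a + B * a
      + r\<^sup>2 * (- A1 * b + B * b - 2 * C * b - C1 * a)
      + r ^ 4 * (- C1 * b)"
  "christoffel_axis_deriv (0, \<i>) (0, \<i>) (0, 1) (0, 1) - christoffel_axis_deriv (0, 1) (0, \<i>) (0, \<i>) (0, 1) = - 2 * A1 * a + B * a - 3 * C * a
      + r\<^sup>2 * (- A1 * b + B * b)"
  by (simp_all add: christoffel_axis_deriv_def sum_Basis_C2 radial_form_simps power2_eq_square power_numeral_reduce algebra_simps)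

definition scalar_axis :: real where
  "scalar_axis = (\<Sum>j\<in>Basis. \<Sum>k\<in>Basis. radial_form a b c (of_real r, 0) j k *
     (\<Sum>i\<in>Basis. christoffel_axis_deriv i i j k - christoffel_axis_deriv j i i k + (\<Sum>m\<in>Basis. christoffel_axis i i m * christoffel_axis m j k - christoffel_axis i j m * christoffel_axis m i k)))"


text \<open>Here the conformal factor is normalized to \<open>v\<^sup>2 = 1\<close> at the point, and \<open>p, p2, f, f2\<close> stand
  for the quotients \<open>v'/v, v''/v, F'/F, F''/F\<close>.\<close>

lemma scalar_axis_eq:
  fixes p p2 F f f2 :: real
  defines "\<beta> \<equiv> (1 / F - 1) / r\<^sup>2"
    and "\<gamma> \<equiv> (F - 1) / r\<^sup>2"
  defines "\<beta>1 \<equiv> - f / (F * r\<^sup>2) - \<beta> / r\<^sup>2"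
    and "\<gamma>1 \<equiv> (F * f - \<gamma>) / r\<^sup>2"
  defines "\<gamma>2 \<equiv> (F * f2 - 2 * \<gamma>1) / r\<^sup>2"
  assumes nz: "F \<noteq> 0" "r \<noteq> 0"
    and A: "A1 = 2 * p" "A2 = 2 * p\<^sup>2 + 2 * p2"
    and B: "B = \<beta>" "B1 = 2 * p * \<beta> + \<beta>1"
    and C: "C = \<gamma>" "C1 = 2 * p * \<gamma> + \<gamma>1"
      "C2 = (2 * p\<^sup>2 + 2 * p2) * \<gamma> + 4 * p * \<gamma>1 + \<gamma>2"
    and a: "a = 1" "a1 = - 2 * p"
    and b: "b = \<gamma>" "b1 = \<gamma>1 - 2 * p * \<gamma>"
    and c: "c = \<beta>" "c1 = \<beta>1 - 2 * p * \<beta>"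
  shows "scalar_axis = - 24 / r\<^sup>2 * ((2 * r\<^sup>2 * F + r ^ 4 * F * f) * p + r ^ 4 * F * p2)
    + 4 * (2 - (2 * F + 4 * r\<^sup>2 * F * f + r ^ 4 * F * f2)) / r\<^sup>2"
proof -
  \<comment> \<open>The radial eigenvalue of the normalized metric is \<open>1 / F\<close> and the
    Hopf eigenvalue is \<open>F\<close>. They are reciprocal, so the inverse has the same shape with
    \<open>\<beta>\<close> and \<open>\<gamma>\<close> exchanged.\<close>
  have X: "a + b * r\<^sup>2 = F" and Y: "a + c * r\<^sup>2 = 1 / F"
    unfolding a b c \<gamma>_def \<beta>_def using nz by (simp_all add: field_simps)
  \<comment> \<open>The coefficient of \<open>i\<close> in the curvature \<open>R(i,j)j\<close>; its
    sum over \<open>i\<close> is the Ricci entry at \<open>j, j\<close>.\<close>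
  define R where "R i j = christoffel_axis_deriv i i j j - christoffel_axis_deriv j i i j + (\<Sum>m\<in>Basis. christoffel_axis i i m * christoffel_axis m j j - christoffel_axis i j m * christoffel_axis m i j)" for i j
  have s: "scalar_axis = F * (\<Sum>i\<in>Basis. R i (1, 0)) + 1 / F * (\<Sum>i\<in>Basis. R i (\<i>, 0))
     + (\<Sum>i\<in>Basis. R i (0, 1)) + (\<Sum>i\<in>Basis. R i (0, \<i>))"
  proof -
    have d: "(\<Sum>k\<in>Basis. radial_form a b c (of_real r, 0) j k * g k) = radial_form a b c (of_real r, 0) j j * g j"
      if "j \<in> Basis" for j and g :: "C2 \<Rightarrow> real"
      using that unfolding Basis_C2 by (auto simp: radial_form_simps)
    have "scalar_axis = (\<Sum>j\<in>Basis. radial_form a b c (of_real r, 0) j j * (\<Sum>i\<in>Basis. R i j))"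
      unfolding scalar_axis_def R_def by (intro sum.cong refl d)
    moreover have "radial_form a b c (of_real r, 0) (1, 0) (1, 0) = F" "radial_form a b c (of_real r, 0) (\<i>, 0) (\<i>, 0) = 1 / F"
      "radial_form a b c (of_real r, 0) (0, 1) (0, 1) = 1" "radial_form a b c (of_real r, 0) (0, \<i>) (0, \<i>) = 1"
      using X Y a by (simp_all add: radial_form_simps power2_eq_square)
    ultimately show ?thesis by (simp add: sum_Basis_C2)
  qed
  have R0: "R i i = 0" for i by (simp add: R_def)
  have g: "r * (a + b * r\<^sup>2) * (A1 + B + B1 * r\<^sup>2) = r * (2 * p - f)"
    "r * (a + b * r\<^sup>2) * (B - A1 - 2 * C - C1 * r\<^sup>2) = (1 - F\<^sup>2) / r - r * F\<^sup>2 * (2 * p + f)"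
    "r * (a + b * r\<^sup>2) * (B - A1) = (1 - F) / r - 2 * r * F * p"
    "r * (a + c * r\<^sup>2) * (A1 + C + C1 * r\<^sup>2) = r * (2 * p + f)"
    "r * a * A1 = 2 * r * p" "- r * a * C = (1 - F) / r" "r * a * C = (F - 1) / r"
    unfolding X Y unfolding A B C a \<gamma>1_def \<beta>1_def \<gamma>_def \<beta>_def using nz
    by (simp_all add: field_simps power2_eq_square)
  note gv = christoffel_axis_values[unfolded g]
  have d:
    "christoffel_axis_deriv (1, 0) (1, 0) (\<i>, 0) (\<i>, 0) - christoffel_axis_deriv (\<i>, 0) (1, 0) (1, 0) (\<i>, 0)
       = 2 * f - 6 * F\<^sup>2 * f - 4 * F\<^sup>2 * p - 4 * r\<^sup>2 * F\<^sup>2 * f * (2 * p + f)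
         - r\<^sup>2 * F\<^sup>2 * (4 * (p2 - p\<^sup>2) + 2 * (f2 - f\<^sup>2))"
    "christoffel_axis_deriv (1, 0) (1, 0) (0, 1) (0, 1) - christoffel_axis_deriv (0, 1) (1, 0) (1, 0) (0, 1)
       = f - 2 * f * F - 4 * F * p - 4 * r\<^sup>2 * F * f * p - 4 * r\<^sup>2 * F * (p2 - p\<^sup>2)"
    "christoffel_axis_deriv (1, 0) (1, 0) (0, \<i>) (0, \<i>) - christoffel_axis_deriv (0, \<i>) (1, 0) (1, 0) (0, \<i>)
       = f - 2 * f * F - 4 * F * p - 4 * r\<^sup>2 * F * f * p - 4 * r\<^sup>2 * F * (p2 - p\<^sup>2)"
    "christoffel_axis_deriv (\<i>, 0) (\<i>, 0) (1, 0) (1, 0) - christoffel_axis_deriv (1, 0) (\<i>, 0) (\<i>, 0) (1, 0)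
       = - 4 * p - 4 * f - 2 * r\<^sup>2 * (2 * (p2 - p\<^sup>2) + f2 - f\<^sup>2)"
    "christoffel_axis_deriv (\<i>, 0) (\<i>, 0) (0, 1) (0, 1) - christoffel_axis_deriv (0, 1) (\<i>, 0) (\<i>, 0) (0, 1) = - 2 * p * F - 2 * p - f"
    "christoffel_axis_deriv (\<i>, 0) (\<i>, 0) (0, \<i>) (0, \<i>) - christoffel_axis_deriv (0, \<i>) (\<i>, 0) (\<i>, 0) (0, \<i>) = - 2 * p * F - 2 * p - f"
    "christoffel_axis_deriv (0, 1) (0, 1) (1, 0) (1, 0) - christoffel_axis_deriv (1, 0) (0, 1) (0, 1) (1, 0) = - 4 * p - f - 4 * r\<^sup>2 * (p2 - p\<^sup>2)"
    "christoffel_axis_deriv (0, \<i>) (0, \<i>) (1, 0) (1, 0) - christoffel_axis_deriv (1, 0) (0, \<i>) (0, \<i>) (1, 0) = - 4 * p - f - 4 * r\<^sup>2 * (p2 - p\<^sup>2)"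
    "christoffel_axis_deriv (0, 1) (0, 1) (\<i>, 0) (\<i>, 0) - christoffel_axis_deriv (\<i>, 0) (0, 1) (0, 1) (\<i>, 0)
       = - (2 * p + f) * F\<^sup>2 - 2 * p - (F - 1)\<^sup>2 / r\<^sup>2"
    "christoffel_axis_deriv (0, \<i>) (0, \<i>) (\<i>, 0) (\<i>, 0) - christoffel_axis_deriv (\<i>, 0) (0, \<i>) (0, \<i>) (\<i>, 0)
       = - (2 * p + f) * F\<^sup>2 - 2 * p - (F - 1)\<^sup>2 / r\<^sup>2"
    "christoffel_axis_deriv (0, 1) (0, 1) (0, \<i>) (0, \<i>) - christoffel_axis_deriv (0, \<i>) (0, 1) (0, 1) (0, \<i>) = - 4 * (F - 1) / r\<^sup>2 - 2 * p * F - 2 * p"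
    "christoffel_axis_deriv (0, \<i>) (0, \<i>) (0, 1) (0, 1) - christoffel_axis_deriv (0, 1) (0, \<i>) (0, \<i>) (0, 1) = - 4 * (F - 1) / r\<^sup>2 - 2 * p * F - 2 * p"
    unfolding christoffel_axis_deriv_values
    unfolding A B C a b c \<gamma>2_def \<gamma>1_def \<beta>1_def \<gamma>_def \<beta>_def using nz
    by (simp_all add: field_simps power_numeral_reduce)
  show ?thesis
    unfolding s sum_Basis_C2 R0
    unfolding R_def d sum_Basis_C2 gv using nz
    by (simp add: field_simps power_numeral_reduce)
qed
end

section \<open>Derivatives of radial forms\<close>

lemma bounded_linear_cscale: "bounded_linear (cscale k)"
  unfolding cscale_def
  by (intro bounded_linear_Pair bounded_linear_compose[OF bounded_linear_mult_right bounded_linear_fst]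
      bounded_linear_compose[OF bounded_linear_mult_right bounded_linear_snd])

lemma inner_cscale_i: "z \<bullet> cscale \<i> z = 0" "cscale \<i> z \<bullet> cscale \<i> z = z \<bullet> z"
  by (simp_all add: cscale_def inner_prod_def inner_complex_def)

lemma has_derivative_radial:
  fixes z :: "'a::real_inner"
  assumes "(A has_real_derivative A1) (at (z \<bullet> z))"
  shows "((\<lambda>y. A (y \<bullet> y)) has_derivative (\<lambda>q. 2 * (z \<bullet> q) * A1)) (at z)"
  by (rule has_derivative_eq_rhs[OF DERIV_compose_FDERIV[OF assms has_derivative_inner[OF has_derivative_ident has_derivative_ident]]])
     (simp add: inner_commute)

lemma has_derivative_inner_cscale:
  "((\<lambda>y. cscale k y \<bullet> v) has_derivative (\<lambda>q. cscale k q \<bullet> v)) (at z)"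
  by (intro bounded_linear_imp_has_derivative
      bounded_linear_compose[OF bounded_linear_inner_left bounded_linear_cscale])

lemma has_derivative_radial_form:
  assumes "(A has_real_derivative A1) (at (z \<bullet> z))" "(B has_real_derivative B1) (at (z \<bullet> z))"
    "(C has_real_derivative C1) (at (z \<bullet> z))"
  shows "((\<lambda>y. radial_form (A (y \<bullet> y)) (B (y \<bullet> y)) (C (y \<bullet> y)) y v w) has_derivative
    (\<lambda>q. radial_form_deriv A1 (B (z \<bullet> z)) B1 (C (z \<bullet> z)) C1 z q v w)) (at z)"
  unfolding radial_form_def radial_form_deriv_def
  by (rule derivative_eq_intros has_derivative_inner_cscale assms[THEN has_derivative_radial] refl)+
     (simp add: fun_eq_iff algebra_simps)

lemma has_derivative_radial_form_deriv:
  assumes "(A1 has_real_derivative A2) (at (z \<bullet> z))"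
    "(B has_real_derivative B1 (z \<bullet> z)) (at (z \<bullet> z))" "(B1 has_real_derivative B2) (at (z \<bullet> z))"
    "(C has_real_derivative C1 (z \<bullet> z)) (at (z \<bullet> z))" "(C1 has_real_derivative C2) (at (z \<bullet> z))"
  shows "((\<lambda>y. radial_form_deriv (A1 (y \<bullet> y)) (B (y \<bullet> y)) (B1 (y \<bullet> y)) (C (y \<bullet> y)) (C1 (y \<bullet> y)) y p v w) has_derivative
    (\<lambda>q. radial_form_deriv2 (A1 (z \<bullet> z)) A2 (B (z \<bullet> z)) (B1 (z \<bullet> z)) B2 (C (z \<bullet> z)) (C1 (z \<bullet> z)) C2 z q p v w)) (at z)"
  unfolding radial_form_def radial_form_deriv_def radial_form_deriv2_def
  by (rule derivative_eq_intros has_derivative_inner_cscale assms[THEN has_derivative_radial] refl)+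
     (simp add: fun_eq_iff algebra_simps)

lemma partial_eqI:
  assumes "open U" "x \<in> U" "\<And>y. y \<in> U \<Longrightarrow> f y = f0 y" "(f0 has_derivative f') (at x)"
  shows "partial i f x = f' i"
proof -
  have "(f has_derivative f') (at x)"
    using has_derivative_transform_within_open[OF assms(4,1,2)] assms(3) by metis
  then show ?thesis
    unfolding partial_def by (metis frechet_derivative_at)
qed

text \<open>The vectors \<open>x\<close> and \<open>cscale \<i> x\<close> are orthogonal with the
  same squared length \<open>x \<bullet> x\<close>. Operators of the form identity plus multiples of
  the two rank-one maps along them are therefore closed under composition, and the three equations
  say that such a composition is the identity.\<close>

lemma metric_inv_radial_form:
  assumes g: "\<And>v w. g x v w = radial_form A B C x v w"
    and inv: "A * a = 1" "A * b + B * a + (x \<bullet> x) * B * b = 0" "A * c + C * a + (x \<bullet> x) * C * c = 0"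
  shows "metric_inv g x i j = radial_form a b c x i j"
proof -
  define op :: "real \<Rightarrow> real \<Rightarrow> real \<Rightarrow> C2 \<Rightarrow> C2" where
    "op A B C v = A *\<^sub>R v + (B * (x \<bullet> v)) *\<^sub>R x + (C * (cscale \<i> x \<bullet> v)) *\<^sub>R cscale \<i> x" for A B C v
  have op: "radial_form A B C x v w = op A B C v \<bullet> w" for A B C v w
    by (simp add: radial_form_def op_def inner_add_left)
  have *: "op A B C (op a b c v) = v" if "A * a = 1" "A * b + B * a + (x \<bullet> x) * B * b = 0" "A * c + C * a + (x \<bullet> x) * C * c = 0"
    for A B C a b c v
  proof -
    have "op A B C (op a b c v) = (A * a) *\<^sub>R v + ((A * b + B * a + (x \<bullet> x) * B * b) * (x \<bullet> v)) *\<^sub>R x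
      + ((A * c + C * a + (x \<bullet> x) * C * c) * (cscale \<i> x \<bullet> v)) *\<^sub>R cscale \<i> x"
      unfolding op_def
      by (simp add: inner_add_right inner_cscale_i inner_cscale_i(1)[of x, unfolded inner_commute[of x]] scaleR_add_right scaleR_add_left distrib_left distrib_right ac_simps)
    then show ?thesis using that by simp
  qed
  have "metric_op g x = op A B C"
    unfolding metric_op_def g op by (simp add: euclidean_representation)
  moreover have "inv (op A B C) = op a b c"
  proof (rule inv_equality)
    show "op a b c (op A B C v) = v" for v
      using inv by (intro *) (simp_all add: ac_simps)
    show "op A B C (op a b c v) = v" for v
      using inv by (intro *)
  qed
  ultimately show ?thesis
    unfolding metric_inv_def by (simp add: op)
qed


text \<open>The bridge from the Frechet derivatives in \<open>scalar_curvature\<close> to the jets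
  in \<open>scalar_axis\<close>. The inverse metric and the Christoffel symbols are computed on a
  whole neighbourhood, because the latter are differentiated once more; only afterwards is the point
  placed on the axis.\<close>

lemma scalar_curvature_radial_form:
  fixes g :: "C2 metric_tensor"
  assumes S: "open S" "r\<^sup>2 \<in> S"
    and g: "\<And>x v w. x \<bullet> x \<in> S \<Longrightarrow> g x v w = radial_form (A (x \<bullet> x)) (B (x \<bullet> x)) (C (x \<bullet> x)) x v w"
    and inv: "\<And>s. s \<in> S \<Longrightarrow> A s * a s = 1" "\<And>s. s \<in> S \<Longrightarrow> A s * b s + B s * a s + s * B s * b s = 0"
      "\<And>s. s \<in> S \<Longrightarrow> A s * c s + C s * a s + s * C s * c s = 0"
    and A: "\<And>s. s \<in> S \<Longrightarrow> (A has_real_derivative A1 s) (at s)"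
      "\<And>s. s \<in> S \<Longrightarrow> (A1 has_real_derivative A2 s) (at s)"
    and B: "\<And>s. s \<in> S \<Longrightarrow> (B has_real_derivative B1 s) (at s)"
      "\<And>s. s \<in> S \<Longrightarrow> (B1 has_real_derivative B2 s) (at s)"
    and C: "\<And>s. s \<in> S \<Longrightarrow> (C has_real_derivative C1 s) (at s)"
      "\<And>s. s \<in> S \<Longrightarrow> (C1 has_real_derivative C2 s) (at s)"
    and a: "\<And>s. s \<in> S \<Longrightarrow> (a has_real_derivative a1 s) (at s)"
    and b: "\<And>s. s \<in> S \<Longrightarrow> (b has_real_derivative b1 s) (at s)"
    and c: "\<And>s. s \<in> S \<Longrightarrow> (c has_real_derivative c1 s) (at s)"
  defines "s0 \<equiv> r\<^sup>2"
  shows "scalar_curvature g (complex_of_real r, 0) =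
    scalar_axis r (A1 s0) (A2 s0) (B s0) (B1 s0) (B2 s0) (C s0) (C1 s0) (C2 s0) (a s0) (a1 s0) (b s0) (b1 s0) (c s0) (c1 s0)"
proof -
  define U where "U = {x::C2. x \<bullet> x \<in> S}"
  define z where "z = (complex_of_real r, 0::complex)"
  have zz: "z \<bullet> z = s0"
    by (simp add: z_def s0_def inner_prod_def inner_complex_def power2_eq_square)
  have zU: "z \<in> U" using S by (simp add: U_def zz s0_def)
  have U: "open U"
  proof -
    have "U = (\<lambda>x. x \<bullet> x) -` S" by (auto simp: U_def)
    then show ?thesis using S(1) by (auto intro!: open_vimage continuous_intros)
  qed
  define d where "d y = radial_form_deriv (A1 (y \<bullet> y)) (B (y \<bullet> y)) (B1 (y \<bullet> y)) (C (y \<bullet> y)) (C1 (y \<bullet> y)) y" for y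
  define h where "h y = radial_form (a (y \<bullet> y)) (b (y \<bullet> y)) (c (y \<bullet> y)) y" for y
  have h: "metric_inv g y i j = h y i j" if "y \<in> U" for y i j
    unfolding h_def
  proof (rule metric_inv_radial_form)
    have y: "y \<bullet> y \<in> S" using that by (simp add: U_def)
    show "g y v w = radial_form (A (y \<bullet> y)) (B (y \<bullet> y)) (C (y \<bullet> y)) y v w" for v w
      by (rule g[OF y])
    show "A (y \<bullet> y) * a (y \<bullet> y) = 1" by (rule inv(1)[OF y])
    show "A (y \<bullet> y) * b (y \<bullet> y) + B (y \<bullet> y) * a (y \<bullet> y) + (y \<bullet> y) * B (y \<bullet> y) * b (y \<bullet> y) = 0"
      by (rule inv(2)[OF y])
    show "A (y \<bullet> y) * c (y \<bullet> y) + C (y \<bullet> y) * a (y \<bullet> y) + (y \<bullet> y) * C (y \<bullet> y) * c (y \<bullet> y) = 0"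
      by (rule inv(3)[OF y])
  qed
  have d: "partial p (\<lambda>y. g y v w) y = d y p v w" if "y \<in> U" for y p v w
    unfolding d_def
    by (rule partial_eqI[OF U that _ has_derivative_radial_form]) (use that in \<open>auto simp: U_def g A B C\<close>)
  have chr: "christoffel g k i j y = (1/2) * (\<Sum>l\<in>Basis. h y k l * (d y i j l + d y j i l - d y l i j))"
    if "y \<in> U" for k i j y
    unfolding christoffel_def using that by (simp add: h d)
  have chr_z: "christoffel g k i j z = christoffel_axis r (A1 s0) (B s0) (B1 s0) (C s0) (C1 s0) (a s0) (b s0) (c s0) k i j" for k i j
    unfolding chr[OF zU] christoffel_axis_def h_def d_def zz by (simp add: z_def)
  have dh: "((\<lambda>y. h y v w) has_derivative (\<lambda>p. radial_form_deriv (a1 s0) (b s0) (b1 s0) (c s0) (c1 s0) z p v w)) (at z)" for v w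
    unfolding h_def zz[symmetric] using zU by (intro has_derivative_radial_form a b c) (auto simp: U_def)
  have dd: "((\<lambda>y. d y p v w) has_derivative
    (\<lambda>q. radial_form_deriv2 (A1 s0) (A2 s0) (B s0) (B1 s0) (B2 s0) (C s0) (C1 s0) (C2 s0) z q p v w)) (at z)" for p v w
    unfolding d_def zz[symmetric] using zU by (intro has_derivative_radial_form_deriv A B C) (auto simp: U_def)
  have dchr: "partial p (christoffel g k i j) z =
    christoffel_axis_deriv r (A1 s0) (A2 s0) (B s0) (B1 s0) (B2 s0) (C s0) (C1 s0) (C2 s0) (a s0) (a1 s0) (b s0) (b1 s0) (c s0) (c1 s0) p k i j"
    for p k i j
  proof (rule trans[OF partial_eqI[OF U zU chr]])
    show "((\<lambda>y. (1/2) * (\<Sum>l\<in>Basis. h y k l * (d y i j l + d y j i l - d y l i j))) has_derivative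
      (\<lambda>p. (1/2) * (\<Sum>l\<in>Basis. h z k l * (
        radial_form_deriv2 (A1 s0) (A2 s0) (B s0) (B1 s0) (B2 s0) (C s0) (C1 s0) (C2 s0) z p i j l +
        radial_form_deriv2 (A1 s0) (A2 s0) (B s0) (B1 s0) (B2 s0) (C s0) (C1 s0) (C2 s0) z p j i l -
        radial_form_deriv2 (A1 s0) (A2 s0) (B s0) (B1 s0) (B2 s0) (C s0) (C1 s0) (C2 s0) z p l i j) +
        radial_form_deriv (a1 s0) (b s0) (b1 s0) (c s0) (c1 s0) z p k l * (d z i j l + d z j i l - d z l i j)))) (at z)"
      by (intro has_derivative_mult_right has_derivative_sum has_derivative_mult has_derivative_add has_derivative_diff dh dd)
  qed (simp_all add: christoffel_axis_deriv_def h_def d_def zz, simp add: z_def algebra_simps)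
  have hz: "h z i j = radial_form (a s0) (b s0) (c s0) (complex_of_real r, 0) i j" for i j
    by (simp add: h_def zz) (simp add: z_def)
  show ?thesis
    unfolding z_def[symmetric] scalar_curvature_def ricci_def riemann_def dchr chr_z h[OF zU] hz scalar_axis_def by (simp add: z_def)
qed

section \<open>Rescaling and conformal change\<close>

lemma radial_form_scale: "radial_form (k * A) (k * B) (k * C) z v w = k * radial_form A B C z v w"
  by (simp add: radial_form_def algebra_simps)

lemma radial_form_deriv_scale: "radial_form_deriv (k * A1) (k * B) (k * B1) (k * C) (k * C1) z p v w = k * radial_form_deriv A1 B B1 C C1 z p v w"
  unfolding radial_form_deriv_def radial_form_scale by (simp add: algebra_simps)

lemma radial_form_deriv2_scale: "radial_form_deriv2 (k * A1) (k * A2) (k * B) (k * B1) (k * B2) (k * C) (k * C1) (k * C2) z q p v w =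
    k * radial_form_deriv2 A1 A2 B B1 B2 C C1 C2 z q p v w"
  unfolding radial_form_deriv2_def radial_form_scale radial_form_deriv_scale by (simp add: algebra_simps)

text \<open>Multiplying a metric by a constant leaves the Christoffel symbols unchanged and divides
  the scalar curvature by that constant. This supplies the normalization \<open>v^2 = 1\<close> at
  the point under which \<open>scalar_axis_eq\<close> is stated.\<close>

lemma scalar_axis_scale:
  assumes k: "k * l = 1"
    and "A1' = k * A1" "A2' = k * A2" "B' = k * B" "B1' = k * B1" "B2' = k * B2" "C' = k * C" "C1' = k * C1" "C2' = k * C2"
    and "a' = l * a" "a1' = l * a1" "b' = l * b" "b1' = l * b1" "c' = l * c" "c1' = l * c1"
  shows "scalar_axis r A1' A2' B' B1' B2' C' C1' C2' a' a1' b' b1' c' c1' =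
    l * scalar_axis r A1 A2 B B1 B2 C C1 C2 a a1 b b1 c c1"
proof -
  have 1: "(l * x) * (k * y + k * z - k * u) = x * (y + z - u)" for x y z u :: real
  proof -
    have "(l * x) * (k * y + k * z - k * u) = (k * l) * (x * (y + z - u))" by (simp add: algebra_simps)
    then show ?thesis by (simp add: k)
  qed
  have g: "christoffel_axis r A1' B' B1' C' C1' a' b' c' = christoffel_axis r A1 B B1 C C1 a b c"
    unfolding assms(2-) by (intro ext) (simp only: christoffel_axis_def radial_form_scale radial_form_deriv_scale 1)
  have d: "christoffel_axis_deriv r A1' A2' B' B1' B2' C' C1' C2' a' a1' b' b1' c' c1' = christoffel_axis_deriv r A1 A2 B B1 B2 C C1 C2 a a1 b b1 c c1"
    unfolding assms(2-) by (intro ext) (simp only: christoffel_axis_deriv_def radial_form_scale radial_form_deriv_scale radial_form_deriv2_scale 1)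
  have f: "radial_form a' b' c' (of_real r, 0) j i = l * radial_form a b c (of_real r, 0) j i" for i j
    unfolding assms(2-) by (rule radial_form_scale)
  show ?thesis
    unfolding scalar_axis_def g d f mult.assoc sum_distrib_left ..
qed

text \<open>The four-dimensional conformal formula \<open>R v^3 = - 6 \<Delta> v + R0 v\<close>,
  with \<open>R0\<close> and \<open>\<Delta>\<close> the scalar curvature and the Laplacian of the
  unscaled metric. For radial \<open>v\<close> these are
  \<open>\<Delta> v = 4 / s (s^2 F v')'\<close> and
  \<open>R0 = 4 (2 - (s^2 F)'') / s\<close>.\<close>

lemma scalar_curvature_conformal:
  fixes g :: "C2 metric_tensor" and v F :: "real \<Rightarrow> real"
  assumes S: "open S" "r\<^sup>2 \<in> S" and pos: "\<And>s. s \<in> S \<Longrightarrow> s > 0" "\<And>s. s \<in> S \<Longrightarrow> v s > 0" "\<And>s. s \<in> S \<Longrightarrow> F s > 0"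
    and g: "\<And>x X Y. x \<bullet> x \<in> S \<Longrightarrow> g x X Y = (v (x \<bullet> x))\<^sup>2 *
      radial_form 1 ((1 / F (x \<bullet> x) - 1) / (x \<bullet> x)) ((F (x \<bullet> x) - 1) / (x \<bullet> x)) x X Y"
    and v: "\<And>s. s \<in> S \<Longrightarrow> (v has_real_derivative v1 s) (at s)" "\<And>s. s \<in> S \<Longrightarrow> (v1 has_real_derivative v2 s) (at s)"
    and F: "\<And>s. s \<in> S \<Longrightarrow> (F has_real_derivative F1 s) (at s)" "\<And>s. s \<in> S \<Longrightarrow> (F1 has_real_derivative F2 s) (at s)"
  defines "t \<equiv> r\<^sup>2"
  shows "scalar_curvature g (of_real r, 0) * v t ^ 3 =
    - 24 / t * ((2 * t * F t + t\<^sup>2 * F1 t) * v1 t + t\<^sup>2 * F t * v2 t)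
    + 4 * v t * (2 - (2 * F t + 4 * t * F1 t + t\<^sup>2 * F2 t)) / t"
proof -
  have nz: "s \<noteq> 0" "v s \<noteq> 0" "F s \<noteq> 0" if "s \<in> S" for s
    using pos[OF that] by auto
  define \<beta> where "\<beta> s = (1 / F s - 1) / s" for s
  define \<beta>1 where "\<beta>1 s = - F1 s / ((F s)\<^sup>2 * s) - (1 / F s - 1) / s\<^sup>2" for s
  define \<beta>2 where "\<beta>2 s = - F2 s / ((F s)\<^sup>2 * s) + 2 * (F1 s)\<^sup>2 / (F s ^ 3 * s) + 2 * F1 s / ((F s)\<^sup>2 * s\<^sup>2)
    + 2 * (1 / F s - 1) / s ^ 3" for s
  define \<gamma> where "\<gamma> s = (F s - 1) / s" for s
  define \<gamma>1 where "\<gamma>1 s = F1 s / s - (F s - 1) / s\<^sup>2" for s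
  define \<gamma>2 where "\<gamma>2 s = F2 s / s - 2 * F1 s / s\<^sup>2 + 2 * (F s - 1) / s ^ 3" for s
  have d\<beta>: "(\<beta> has_real_derivative \<beta>1 s) (at s)" if s: "s \<in> S" for s
    unfolding \<beta>_def \<beta>1_def using nz[OF s]
    by (auto intro!: derivative_eq_intros F s simp: field_simps power2_eq_square)
  have d\<beta>1: "(\<beta>1 has_real_derivative \<beta>2 s) (at s)" if s: "s \<in> S" for s
    unfolding \<beta>1_def \<beta>2_def using nz[OF s]
    by (auto intro!: derivative_eq_intros F s simp: field_simps power2_eq_square power3_eq_cube)
  have d\<gamma>: "(\<gamma> has_real_derivative \<gamma>1 s) (at s)" if s: "s \<in> S" for s
    unfolding \<gamma>_def \<gamma>1_def using nz[OF s]
    by (auto intro!: derivative_eq_intros F s simp: field_simps power2_eq_square)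
  have d\<gamma>1: "(\<gamma>1 has_real_derivative \<gamma>2 s) (at s)" if s: "s \<in> S" for s
    unfolding \<gamma>1_def \<gamma>2_def using nz[OF s]
    by (auto intro!: derivative_eq_intros F s simp: field_simps power2_eq_square power3_eq_cube)
  define V where "V s = (v s)\<^sup>2" for s
  define V1 where "V1 s = 2 * v s * v1 s" for s
  define V2 where "V2 s = 2 * (v1 s)\<^sup>2 + 2 * v s * v2 s" for s
  define W where "W s = 1 / (v s)\<^sup>2" for s
  define W1 where "W1 s = - 2 * v1 s / v s ^ 3" for s
  have dV: "(V has_real_derivative V1 s) (at s)" if s: "s \<in> S" for s
    unfolding V_def V1_def by (auto intro!: derivative_eq_intros v s)
  have dV1: "(V1 has_real_derivative V2 s) (at s)" if s: "s \<in> S" for s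
    unfolding V1_def V2_def by (auto intro!: derivative_eq_intros v s simp: power2_eq_square)
  have dW: "(W has_real_derivative W1 s) (at s)" if s: "s \<in> S" for s
    unfolding W_def W1_def using nz[OF s]
    by (auto intro!: derivative_eq_intros v s simp: field_simps power2_eq_square power3_eq_cube)
  have VW: "V s * W s = 1" if "s \<in> S" for s
    using nz[OF that] by (simp add: V_def W_def)
  \<comment> \<open>This is \<open>(1 + s \<beta>) (1 + s \<gamma>) = 1\<close>, the reciprocity of
    the radial and Hopf eigenvalues \<open>1 / F\<close> and \<open>F\<close>.\<close>
  have inv1: "\<gamma> s + \<beta> s + s * \<beta> s * \<gamma> s = 0" if "s \<in> S" for s
    using nz[OF that] by (simp add: \<beta>_def \<gamma>_def field_simps)
  have "scalar_curvature g (of_real r, 0) = scalar_axis r (V1 t) (V2 t)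
      (V t * \<beta> t) (V1 t * \<beta> t + \<beta>1 t * V t) ((V2 t * \<beta> t + \<beta>1 t * V1 t) + (\<beta>2 t * V t + V1 t * \<beta>1 t))
      (V t * \<gamma> t) (V1 t * \<gamma> t + \<gamma>1 t * V t) ((V2 t * \<gamma> t + \<gamma>1 t * V1 t) + (\<gamma>2 t * V t + V1 t * \<gamma>1 t))
      (W t) (W1 t) (W t * \<gamma> t) (W1 t * \<gamma> t + \<gamma>1 t * W t) (W t * \<beta> t) (W1 t * \<beta> t + \<beta>1 t * W t)"
    unfolding t_def
  proof (rule scalar_curvature_radial_form[OF S])
    show "g x X Y = radial_form (V (x \<bullet> x)) (V (x \<bullet> x) * \<beta> (x \<bullet> x)) (V (x \<bullet> x) * \<gamma> (x \<bullet> x)) x X Y"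
      if "x \<bullet> x \<in> S" for x X Y
      unfolding g[OF that] V_def \<beta>_def \<gamma>_def radial_form_scale[symmetric] by simp
    show "V s * W s = 1" if "s \<in> S" for s using VW[OF that] .
    show "V s * (W s * \<gamma> s) + V s * \<beta> s * W s + s * (V s * \<beta> s) * (W s * \<gamma> s) = 0" if "s \<in> S" for s
    proof -
      have "V s * (W s * \<gamma> s) + V s * \<beta> s * W s + s * (V s * \<beta> s) * (W s * \<gamma> s) =
        V s * W s * (\<gamma> s + \<beta> s + s * \<beta> s * \<gamma> s)" by (simp add: algebra_simps)
      then show ?thesis using inv1[OF that] by simp
    qed
    show "V s * (W s * \<beta> s) + V s * \<gamma> s * W s + s * (V s * \<gamma> s) * (W s * \<beta> s) = 0" if "s \<in> S" for s
    proof -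
      have "V s * (W s * \<beta> s) + V s * \<gamma> s * W s + s * (V s * \<gamma> s) * (W s * \<beta> s) =
        V s * W s * (\<gamma> s + \<beta> s + s * \<beta> s * \<gamma> s)" by (simp add: algebra_simps)
      then show ?thesis using inv1[OF that] by simp
    qed
  qed (intro DERIV_mult DERIV_add dV dV1 dW d\<beta> d\<beta>1 d\<gamma> d\<gamma>1; assumption)+
  also have "\<dots> = W t * scalar_axis r (2 * (v1 t / v t)) (2 * (v1 t / v t)\<^sup>2 + 2 * (v2 t / v t))
      (\<beta> t) (2 * (v1 t / v t) * \<beta> t + \<beta>1 t) (W t * ((V2 t * \<beta> t + \<beta>1 t * V1 t) + (\<beta>2 t * V t + V1 t * \<beta>1 t)))
      (\<gamma> t) (2 * (v1 t / v t) * \<gamma> t + \<gamma>1 t)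
      ((2 * (v1 t / v t)\<^sup>2 + 2 * (v2 t / v t)) * \<gamma> t + 4 * (v1 t / v t) * \<gamma>1 t + \<gamma>2 t)
      1 (- 2 * (v1 t / v t)) (\<gamma> t) (\<gamma>1 t - 2 * (v1 t / v t) * \<gamma> t) (\<beta> t) (\<beta>1 t - 2 * (v1 t / v t) * \<beta> t)"
    using nz[OF S(2)[folded t_def]] VW[OF S(2)[folded t_def]]
    by (intro scalar_axis_scale[of "V t"])
       (simp_all add: V_def V1_def V2_def W_def W1_def field_simps power2_eq_square power3_eq_cube)
  also have "\<dots> = W t * (- 24 / t * ((2 * t * F t + t\<^sup>2 * F1 t) * (v1 t / v t) + t\<^sup>2 * F t * (v2 t / v t))
    + 4 * (2 - (2 * F t + 4 * t * F1 t + t\<^sup>2 * F2 t)) / t)"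
    using nz[OF S(2)]
    by (subst scalar_axis_eq[where p = "v1 t / v t" and ?p2.0 = "v2 t / v t" and F = "F t" and f = "F1 t / F t" and ?f2.0 = "F2 t / F t"])
       (simp_all add: t_def \<beta>_def \<beta>1_def \<gamma>_def \<gamma>1_def \<gamma>2_def field_simps power_numeral_reduce)
  finally show ?thesis
    using nz[OF S(2)] by (simp add: t_def W_def field_simps power_numeral_reduce)
qed

section \<open>Smooth functions\<close>

lemma frechet_derivative_cong_open:
  assumes "open S" "x \<in> S" "\<And>y. y \<in> S \<Longrightarrow> f y = g y"
  shows "frechet_derivative f (at x) = frechet_derivative g (at x)"
proof -
  have "(f has_derivative f') (at x) \<longleftrightarrow> (g has_derivative f') (at x)" for f'
    using has_derivative_transform_within_open[OF _ assms(1,2)] assms(3) by (metis (no_types, lifting))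
  then show ?thesis unfolding frechet_derivative_def by simp
qed

lemma differentiable_cong_open:
  assumes "open S" "x \<in> S" "\<And>y. y \<in> S \<Longrightarrow> f y = g y" "f differentiable (at x)"
  shows "g differentiable (at x)"
proof -
  obtain D where "(f has_derivative D) (at x)"
    using assms(4) by (auto simp: differentiable_def)
  then have "(g has_derivative D) (at x)"
    by (rule has_derivative_transform_within_open[OF _ assms(1,2)]) (rule assms(3))
  then show ?thesis by (auto simp: differentiable_def)
qed

lemma Ck_on_cong:
  assumes "open S" "\<And>y. y \<in> S \<Longrightarrow> f y = g y" "Ck_on k S f"
  shows "Ck_on k S g"
  using assms(2,3)
proof (induction k arbitrary: f g)
  case 0
  then show ?case using continuous_on_cong[of S S f g] by auto
next
  case (Suc k)
  show ?case
    unfolding Ck_on.simps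
  proof (intro conjI ballI allI)
    show "g differentiable (at x)" if "x \<in> S" for x
      using differentiable_cong_open[OF assms(1) that Suc.prems(1)] Suc.prems(2) that by simp
    show "Ck_on k S (\<lambda>x. frechet_derivative g (at x) v)" for v
    proof (rule Suc.IH)
      show "frechet_derivative f (at x) v = frechet_derivative g (at x) v" if "x \<in> S" for x
        using frechet_derivative_cong_open[OF assms(1) that Suc.prems(1)] by (rule arg_cong)
      show "Ck_on k S (\<lambda>x. frechet_derivative f (at x) v)"
        using Suc.prems(2) by simp
    qed
  qed
qed

lemma Ck_on_SucI:
  assumes "open S" "\<And>x. x \<in> S \<Longrightarrow> (f has_derivative D x) (at x)" "\<And>v. Ck_on k S (\<lambda>x. D x v)"
  shows "Ck_on (Suc k) S f"
  unfolding Ck_on.simps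
proof (intro conjI ballI allI)
  show "f differentiable (at x)" if "x \<in> S" for x
    using assms(2)[OF that] by (auto simp: differentiable_def)
  show "Ck_on k S (\<lambda>x. frechet_derivative f (at x) v)" for v
  proof (rule Ck_on_cong[OF assms(1) _ assms(3)])
    show "D x v = frechet_derivative f (at x) v" if "x \<in> S" for x
      by (rule fun_cong[OF frechet_derivative_at[OF assms(2)[OF that]]])
  qed
qed

lemma Ck_on_SucD:
  assumes "Ck_on (Suc k) S f"
  shows "x \<in> S \<Longrightarrow> (f has_derivative frechet_derivative f (at x)) (at x)"
    "Ck_on k S (\<lambda>x. frechet_derivative f (at x) v)"
  using assms by (auto simp: frechet_derivative_works)

text \<open>The product and quotient rules leave undifferentiated factors, which must be brought
  down to the order of the derivatives beside them.\<close>

lemma Ck_on_Suc_imp: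
  assumes "open S" "Ck_on (Suc k) S f"
  shows "Ck_on k S f"
  using assms(2)
proof (induction k arbitrary: f)
  case 0
  then show ?case
    by (auto intro!: continuous_at_imp_continuous_on differentiable_imp_continuous_within)
next
  case (Suc k)
  show ?case
    by (rule Ck_on_SucI[OF assms(1) Ck_on_SucD(1)[OF Suc.prems] Suc.IH[OF Ck_on_SucD(2)[OF Suc.prems]]])
qed

lemma Ck_on_const: "open S \<Longrightarrow> Ck_on k S (\<lambda>x. a)"
proof (induction k arbitrary: a)
  case (Suc k)
  show ?case by (rule Ck_on_SucI[OF Suc.prems has_derivative_const Suc.IH[OF Suc.prems]])
qed simp

lemma Ck_on_linear:
  assumes "open S" "bounded_linear f"
  shows "Ck_on k S f"
proof (cases k)
  case 0
  then show ?thesis using assms by (auto intro: linear_continuous_on)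
next
  case (Suc j)
  show ?thesis
    unfolding Suc
    by (rule Ck_on_SucI[OF assms(1) bounded_linear_imp_has_derivative[OF assms(2)] Ck_on_const[OF assms(1)]])
qed

lemma Ck_on_add:
  assumes "open S" "Ck_on k S f" "Ck_on k S g"
  shows "Ck_on k S (\<lambda>x. f x + g x)"
  using assms(2,3)
proof (induction k arbitrary: f g)
  case 0
  then show ?case by (auto intro: continuous_intros)
next
  case (Suc k)
  show ?case
    by (rule Ck_on_SucI[OF assms(1) has_derivative_add[OF Suc.prems[THEN Ck_on_SucD(1)]]
          Suc.IH[OF Suc.prems[THEN Ck_on_SucD(2)]]])
qed

lemma Ck_on_scaleR:
  fixes a :: "'a::euclidean_space \<Rightarrow> real" and f :: "'a \<Rightarrow> 'b::real_normed_vector"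
  assumes "open S" "Ck_on k S a" "Ck_on k S f"
  shows "Ck_on k S (\<lambda>x. a x *\<^sub>R f x)"
  using assms(2,3)
proof (induction k arbitrary: a f)
  case 0
  then show ?case by (auto intro: continuous_intros)
next
  case (Suc k)
  show ?case
    by (rule Ck_on_SucI[OF assms(1) has_derivative_scaleR[OF Suc.prems[THEN Ck_on_SucD(1)]]
          Ck_on_add[OF assms(1)
            Suc.IH[OF Ck_on_Suc_imp[OF assms(1) Suc.prems(1)] Ck_on_SucD(2)[OF Suc.prems(2)]]
            Suc.IH[OF Ck_on_SucD(2)[OF Suc.prems(1)] Ck_on_Suc_imp[OF assms(1) Suc.prems(2)]]]])
qed

text \<open>The derivative of the reciprocal contains the reciprocal again, but only to order
  \<open>k\<close>, which the induction hypothesis provides.\<close>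

lemma Ck_on_inverse:
  fixes a :: "'a::euclidean_space \<Rightarrow> real"
  assumes "open S" "\<And>x. x \<in> S \<Longrightarrow> a x \<noteq> 0" "Ck_on k S a"
  shows "Ck_on k S (\<lambda>x. inverse (a x))"
  using assms(3)
proof (induction k)
  case 0
  then show ?case using assms(2) by (auto intro: continuous_intros)
next
  case (Suc k)
  have inv: "Ck_on k S (\<lambda>x. inverse (a x))" by (rule Suc.IH[OF Ck_on_Suc_imp[OF assms(1) Suc.prems]])
  have D: "((\<lambda>x. inverse (a x)) has_derivative
      (\<lambda>v. - (inverse (a x) * frechet_derivative a (at x) v * inverse (a x)))) (at x)" if "x \<in> S" for x
    by (rule Deriv.has_derivative_inverse[OF assms(2)[OF that] Ck_on_SucD(1)[OF Suc.prems that]])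
  have C: "Ck_on k S (\<lambda>x. - (inverse (a x) * frechet_derivative a (at x) v * inverse (a x)))" for v
  proof -
    have "(\<lambda>x. inverse (a x) *\<^sub>R (frechet_derivative a (at x) v *\<^sub>R ((- 1) *\<^sub>R inverse (a x)))) =
        (\<lambda>x. - (inverse (a x) * frechet_derivative a (at x) v * inverse (a x)))"
      by (rule ext) (simp only: real_scaleR_def mult_minus_left mult_minus_right mult_1_left mult.assoc)
    then show ?thesis
      using Ck_on_scaleR[OF assms(1) inv Ck_on_scaleR[OF assms(1) Ck_on_SucD(2)[OF Suc.prems, of v]
          Ck_on_scaleR[OF assms(1) Ck_on_const[OF assms(1), of k "-1"] inv]]] by metis
  qed
  show ?case
    by (rule Ck_on_SucI[where D = "\<lambda>x v. - (inverse (a x) * frechet_derivative a (at x) v * inverse (a x))",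
          OF assms(1) D C])
qed

text \<open>The inversion is the transition from the chart at the added point to the end chart, and
  \<open>local_lift\<close> demands its smoothness.\<close>

lemma smooth_on_inversion:
  fixes S :: "'a::euclidean_space set"
  assumes "open S" "0 \<notin> S"
  shows "smooth_on S (\<lambda>y. y /\<^sub>R (norm y)\<^sup>2)"
  unfolding smooth_on_def
proof
  fix k
  have norm2: "Ck_on k S (\<lambda>y. (norm y)\<^sup>2)" for k
  proof (cases k)
    case 0
    then show ?thesis by (auto intro: continuous_intros)
  next
    case (Suc j)
    have *: "((\<lambda>y. (norm y)\<^sup>2) has_derivative (\<lambda>q. 2 * (q \<bullet> x))) (at x)" for x :: 'a
      unfolding power2_norm_eq_inner by (auto intro!: derivative_eq_intros simp: inner_commute)
    have "bounded_linear (\<lambda>x. 2 * (v \<bullet> x))" for v :: 'a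
      by (rule bounded_linear_const_mult[OF bounded_linear_inner_right])
    then have "Ck_on j S (\<lambda>x. 2 * (v \<bullet> x))" for v :: 'a
      by (rule Ck_on_linear[OF assms(1)])
    then show ?thesis
      unfolding Suc by (rule Ck_on_SucI[OF assms(1) *])
  qed
  show "Ck_on k S (\<lambda>y. y /\<^sub>R (norm y)\<^sup>2)"
    by (rule Ck_on_scaleR[OF assms(1) Ck_on_inverse[OF assms(1) _ norm2]
          Ck_on_linear[OF assms(1) bounded_linear_ident]]) (use assms(2) in auto)
qed

text \<open>Turns smoothness of the given data into ordinary derivatives along two lines: a fibre
  crossing the projective line and a ray from the added point.\<close>

lemma smooth_on_line:
  fixes f :: "'a::euclidean_space \<Rightarrow> real"
  assumes "smooth_on U f"
  obtains f1 f2 where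
    "\<And>t. a + t *\<^sub>R e \<in> U \<Longrightarrow> ((\<lambda>t. f (a + t *\<^sub>R e)) has_real_derivative f1 t) (at t)"
    "\<And>t. a + t *\<^sub>R e \<in> U \<Longrightarrow> (f1 has_real_derivative f2 t) (at t)"
proof -
  have line: "((\<lambda>t. g (a + t *\<^sub>R e)) has_real_derivative frechet_derivative g (at (a + t *\<^sub>R e)) e) (at t)"
    if "Ck_on (Suc k) U g" "a + t *\<^sub>R e \<in> U" for g :: "'a \<Rightarrow> real" and k t
  proof -
    let ?D = "frechet_derivative g (at (a + t *\<^sub>R e))"
    have "(g has_derivative ?D) (at (a + t *\<^sub>R e))"
      by (rule Ck_on_SucD(1)[OF that])
    moreover from this have "?D (x *\<^sub>R e) = x * ?D e" for x
      by (simp add: linear_scale has_derivative_linear)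
    moreover have "((\<lambda>t. a + t *\<^sub>R e) has_derivative (\<lambda>x. x *\<^sub>R e)) (at t)"
      by (auto intro!: derivative_eq_intros)
    ultimately show ?thesis
      using has_derivative_compose[of "\<lambda>t. a + t *\<^sub>R e" "\<lambda>x. x *\<^sub>R e" t UNIV g ?D]
      by (simp add: has_field_derivative_def mult_commute_abs)
  qed
  have Ck: "Ck_on k U f" for k using assms by (simp add: smooth_on_def)
  show thesis
    by (rule that[OF line[OF Ck] line[OF Ck_on_SucD(2)[OF Ck]]])
qed

section \<open>Invariant conformal factors on LeBrun metrics\<close>

text \<open>\<open>lebrun_F n\<close> in the variable \<open>s = r^2\<close>. By
  \<open>profile_eq\<close>, \<open>s^2\<close> times it is the polynomial \<open>P\<close> of the
  radial equation.\<close>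

definition profile :: "nat \<Rightarrow> real \<Rightarrow> real" where
  "profile n s = 1 + (real n - 2) / s + (1 - real n) / s\<^sup>2"

lemma profile_eq: "s \<noteq> 0 \<Longrightarrow> profile n s = (s - 1) * (s + (real n - 1)) / s\<^sup>2"
  by (simp add: profile_def field_simps power2_eq_square)

lemma profile_pos:
  assumes "n > 1" "s > 1"
  shows "profile n s > 0"
  using assms by (simp add: profile_eq)

text \<open>Parseval's identity: the three left-invariant fields and \<open>z\<close> itself are
  four orthogonal vectors of squared length \<open>z \<bullet> z\<close>.\<close>

lemma left_invariant_frame:
  fixes z :: C2
  shows "((- cnj (snd z), cnj (fst z)) \<bullet> v) * ((- cnj (snd z), cnj (fst z)) \<bullet> w) +
     ((- \<i> * cnj (snd z), \<i> * cnj (fst z)) \<bullet> v) * ((- \<i> * cnj (snd z), \<i> * cnj (fst z)) \<bullet> w) +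
     (cscale \<i> z \<bullet> v) * (cscale \<i> z \<bullet> w) + (z \<bullet> v) * (z \<bullet> w) = (z \<bullet> z) * (v \<bullet> w)"
  by (simp add: cscale_def inner_prod_def inner_complex_def algebra_simps)

text \<open>\<open>left_invariant_frame\<close> trades the first two coframe terms for the Euclidean
  product minus its radial and Hopf parts; the radial and Hopf coefficients are then corrected to
  \<open>1 / F\<close> and \<open>F\<close>.\<close>

lemma lebrun_tensor_eq_radial_form:
  fixes n :: nat
  assumes z: "z \<noteq> 0"
  defines "F \<equiv> profile n (z \<bullet> z)"
  shows "lebrun_tensor n z v w = radial_form 1 ((1 / F - 1) / (z \<bullet> z)) ((F - 1) / (z \<bullet> z)) z v w"
proof -
  define s where "s = z \<bullet> z"
  have s: "s > 0" using z by (simp add: s_def)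
  have r2: "(norm z)\<^sup>2 = s" by (simp add: s_def power2_norm_eq_inner)
  have r4: "norm z ^ 4 = s\<^sup>2" unfolding r2[symmetric] by simp
  have F: "lebrun_F n (norm z) = F"
    unfolding lebrun_F_def r2 r4 F_def profile_def s_def ..
  have dr: "dr z x = (z \<bullet> x) / norm z" for x
  proof -
    have "frechet_derivative norm (at z) = (\<lambda>h. h \<bullet> sgn z)"
      by (rule frechet_derivative_at[OF has_derivative_norm[OF z], symmetric])
    then show ?thesis by (simp add: dr_def sgn_div_norm inner_commute divide_inverse mult.commute)
  qed
  have drdr: "dr z v * dr z w = (z \<bullet> v) * (z \<bullet> w) / s"
    by (simp add: dr r2[symmetric] power2_eq_square)
  have sig3: "sigma3 z v * sigma3 z w = (cscale \<i> z \<bullet> v) * (cscale \<i> z \<bullet> w) / s\<^sup>2"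
    unfolding sigma3_def r2 cscale_def by (simp add: power2_eq_square)
  have sig: "sigma1 z v * sigma1 z w + sigma2 z v * sigma2 z w =
     (s * (v \<bullet> w) - (cscale \<i> z \<bullet> v) * (cscale \<i> z \<bullet> w) - (z \<bullet> v) * (z \<bullet> w)) / s\<^sup>2"
    unfolding left_invariant_frame[of z v w, folded s_def, symmetric] sigma1_def sigma2_def r2
    by (simp add: power2_eq_square add_divide_distrib)
  have "lebrun_tensor n z v w = (z \<bullet> v) * (z \<bullet> w) / s / F +
     s * ((s * (v \<bullet> w) - (cscale \<i> z \<bullet> v) * (cscale \<i> z \<bullet> w) - (z \<bullet> v) * (z \<bullet> w)) / s\<^sup>2
       + F * ((cscale \<i> z \<bullet> v) * (cscale \<i> z \<bullet> w) / s\<^sup>2))"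
    unfolding lebrun_tensor_def Let_def F r2 drdr sig sig3 ..
  also have "\<dots> = radial_form 1 ((1 / F - 1) / s) ((F - 1) / s) z v w"
    using s by (simp add: radial_form_def field_simps power2_eq_square)
  finally show ?thesis by (simp add: s_def)
qed

section \<open>The action of SU(2) on spheres and orbits\<close>

definition su2_matrix :: "complex \<Rightarrow> complex \<Rightarrow> complex^2^2" where
  "su2_matrix a b = vector [vector [a, - cnj b], vector [b, cnj a]]"

lemma su2_matrix_SU2:
  assumes "(cmod a)\<^sup>2 + (cmod b)\<^sup>2 = 1"
  shows "su2_matrix a b \<in> SU2"
proof -
  have 1: "a * cnj a + b * cnj b = 1"
    using assms by (metis complex_norm_square of_real_1 of_real_add)
  then show ?thesis
    unfolding SU2_def su2_matrix_def
    by (simp add: vec_eq_iff forall_2 matrix_matrix_mult_def sum_2 det_2 mat_def mult.commute add.commute)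
qed

lemma mat_act_su2_matrix: "mat_act (su2_matrix a b) z = (a * fst z - cnj b * snd z, b * fst z + cnj a * snd z)"
  by (simp add: mat_act_def su2_matrix_def)

lemma inner_mat_act_su2_matrix:
  assumes "(cmod a)\<^sup>2 + (cmod b)\<^sup>2 = 1"
  shows "mat_act (su2_matrix a b) v \<bullet> mat_act (su2_matrix a b) w = v \<bullet> w"
proof -
  have "mat_act (su2_matrix a b) v \<bullet> mat_act (su2_matrix a b) w = ((cmod a)\<^sup>2 + (cmod b)\<^sup>2) * (v \<bullet> w)"
    unfolding mat_act_su2_matrix cmod_power2 inner_prod_def inner_complex_def
    by (simp add: power2_eq_square algebra_simps)
  then show ?thesis using assms by simp
qed

lemma bounded_linear_mat_act: "bounded_linear (mat_act A)"
  unfolding mat_act_def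
  by (intro bounded_linear_Pair bounded_linear_add
      bounded_linear_compose[OF bounded_linear_mult_right bounded_linear_fst]
      bounded_linear_compose[OF bounded_linear_mult_right bounded_linear_snd])

lemma mat_act_cscale: "mat_act A (cscale c z) = cscale c (mat_act A z)"
  by (simp add: mat_act_def cscale_def algebra_simps)

lemma lebrun_orbit_mat_act:
  assumes "norm (mat_act A z) = norm z"
  shows "lebrun_orbit n (mat_act A z) = mat_act A ` lebrun_orbit n z"
proof -
  have "lebrun_orbit n y = (\<lambda>c. cscale c y) ` {c. cmod c = 1 \<and> (norm y = 1 \<or> c ^ n = 1)}" for y
    by (auto simp: lebrun_orbit_def)
  then show ?thesis by (simp add: assms image_image mat_act_cscale)
qed

lemma preserves_metricD:
  assumes "preserves_metric \<A> F h" "C \<in> \<A>" "D \<in> \<A>" "local_lift F C D V l" "x \<in> V"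
  shows "h D (l x) (frechet_derivative l (at x) v) (frechet_derivative l (at x) w) = h C x v w"
  using assms unfolding preserves_metric_def by blast

lemma Xhat_atlas_charts:
  "end_chart n \<in> Xhat_atlas n" "tube_chart1 n \<in> Xhat_atlas n" "infinity_chart n \<in> Xhat_atlas n"
  by (simp_all add: Xhat_atlas_def X_atlas_def)

text \<open>SU(2) is transitive on spheres: the matrix with first column \<open>z / r\<close>
  carries \<open>(r, 0)\<close> to \<open>z\<close>. Invariance of \<open>h\<close> is tested on the
  radial vector, whose squared length under the LeBrun tensor, \<open>r^2 / profile n (r^2)\<close>,
  depends on \<open>r\<close> alone and so cancels.\<close>

lemma SU2_invariant_conformal_factor_radial:
  assumes n: "n > 1" and inv: "SU2_invariant n h"
    and h: "\<And>z v w. norm z > 1 \<Longrightarrow>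
      h (end_chart n) z v w = \<phi> (Some (lebrun_orbit n z)) * lebrun_tensor n z v w"
    and z: "norm z > 1"
  shows "\<phi> (Some (lebrun_orbit n z)) = \<phi> (Some (lebrun_orbit n (of_real (norm z), 0)))"
proof -
  define r where "r = norm z"
  have r: "r > 1" using z by (simp add: r_def)
  define a b where "a = fst z / of_real r" and "b = snd z / of_real r"
  have "(cmod (fst z))\<^sup>2 + (cmod (snd z))\<^sup>2 = r\<^sup>2"
    unfolding r_def norm_prod_def by simp
  then have ab: "(cmod a)\<^sup>2 + (cmod b)\<^sup>2 = 1"
    using r by (simp add: a_def b_def norm_divide power_divide add_divide_distrib[symmetric])
  define A where "A = su2_matrix a b"
  define x where "x = (complex_of_real r, 0::complex)"
  have nx: "norm x = r" using r by (simp add: x_def norm_prod_def)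
  have Ax: "mat_act A x = z"
    using r by (simp add: A_def mat_act_su2_matrix x_def a_def b_def)
  have in_A: "mat_act A v \<bullet> mat_act A w = v \<bullet> w" for v w
    unfolding A_def by (rule inner_mat_act_su2_matrix[OF ab])
  have norm_A: "norm (mat_act A v) = norm v" for v
    using in_A[of v v] by (simp add: norm_eq_sqrt_inner)
  let ?E = "end_chart n"
  have lift: "local_lift (point_act A) ?E ?E {z. norm z > 1} (mat_act A)"
    unfolding local_lift_def
  proof (intro conjI ballI)
    show "open {z::C2. norm z > 1}"
      by (intro open_Collect_less continuous_intros)
    then show "smooth_on {z. norm z > 1} (mat_act A)"
      unfolding smooth_on_def by (auto intro: Ck_on_linear bounded_linear_mat_act)
  qed (auto simp: end_chart_def norm_A point_act_def lebrun_orbit_mat_act)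
  have "preserves_metric (Xhat_atlas n) (point_act A) h"
    using inv su2_matrix_SU2[OF ab] by (simp add: SU2_invariant_def A_def)
  then have "h ?E (mat_act A x) (frechet_derivative (mat_act A) (at x) x) (frechet_derivative (mat_act A) (at x) x) = h ?E x x x"
    by (rule preserves_metricD[OF _ Xhat_atlas_charts(1) Xhat_atlas_charts(1) lift]) (use nx r in simp)
  moreover have "frechet_derivative (mat_act A) (at x) = mat_act A"
    by (rule frechet_derivative_at[OF bounded_linear_imp_has_derivative[OF bounded_linear_mat_act], symmetric])
  ultimately have "h ?E z z z = h ?E x x x" by (simp add: Ax)
  then have eq: "\<phi> (Some (lebrun_orbit n z)) * lebrun_tensor n z z z = \<phi> (Some (lebrun_orbit n x)) * lebrun_tensor n x x x"
    using h z nx r by simp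
  have L: "lebrun_tensor n y y y = r\<^sup>2 / profile n (r\<^sup>2)" if "norm y = r" for y
  proof -
    have "y \<bullet> y = r\<^sup>2" unfolding that[symmetric] by (simp add: power2_norm_eq_inner)
    moreover have "y \<noteq> 0" using that r by auto
    ultimately show ?thesis
      using r profile_pos[OF n, of "r\<^sup>2"]
      by (simp add: lebrun_tensor_eq_radial_form radial_form_def inner_cscale_i inner_cscale_i(1)[of y, unfolded inner_commute[of y]]
          one_less_power field_simps power2_eq_square)
  qed
  have "r\<^sup>2 / profile n (r\<^sup>2) \<noteq> 0" using r profile_pos[OF n, of "r\<^sup>2"] by (simp add: one_less_power)
  with eq show ?thesis unfolding L[OF nx] L[OF r_def[symmetric]] by (simp add: x_def r_def)
qed

section \<open>Charts at the added point and at the projective line\<close>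

lemma has_derivative_inversion:
  fixes x :: "'a::real_inner"
  assumes "x \<noteq> 0"
  shows "((\<lambda>y. y /\<^sub>R (norm y)\<^sup>2) has_derivative
    (\<lambda>v. v /\<^sub>R (norm x)\<^sup>2 - (2 * (x \<bullet> v) / ((norm x)\<^sup>2)\<^sup>2) *\<^sub>R x)) (at x)"
proof -
  have "((\<lambda>y. (norm y)\<^sup>2) has_derivative (\<lambda>v. 2 * (x \<bullet> v))) (at x)"
    unfolding power2_norm_eq_inner by (auto intro!: derivative_eq_intros simp: inner_commute)
  from has_derivative_scaleR[OF Deriv.has_derivative_inverse[OF _ this] has_derivative_ident] show ?thesis
    by (rule has_derivative_eq_rhs)
       (use assms in \<open>simp_all add: fun_eq_iff power2_eq_square divide_inverse mult.assoc mult.left_commute mult.commute\<close>)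
qed

text \<open>On the axis the test vector \<open>(0, 1)\<close> is orthogonal to the radial and Hopf
  directions, so \<open>F\<close> does not enter: the LeBrun tensor is Euclidean on it. The
  inversion stretches it by \<open>1 / t^2\<close>, which accounts for \<open>t ^ 4\<close>.\<close>

lemma infinity_chart_conformal_factor:
  assumes om: "orbifold_metric (Xhat_atlas n) h"
    and h: "\<And>z v w. norm z > 1 \<Longrightarrow>
      h (end_chart n) z v w = \<phi> (Some (lebrun_orbit n z)) * lebrun_tensor n z v w"
    and t: "0 < t" "t < 1"
  shows "\<phi> (Some (lebrun_orbit n (of_real (1 / t), 0))) = t ^ 4 * h (infinity_chart n) (of_real t, 0) (0, 1) (0, 1)"
proof -
  let ?l = "\<lambda>y::C2. y /\<^sub>R (norm y)\<^sup>2"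
  let ?x = "(complex_of_real t, 0::complex)"
  let ?V = "ball 0 1 - {0::C2}"
  have V: "open ?V" by auto
  have lift: "local_lift id (infinity_chart n) (end_chart n) ?V ?l"
    unfolding local_lift_def
  proof (intro conjI ballI)
    show "smooth_on ?V ?l" by (rule smooth_on_inversion[OF V]) simp
    show "?l ` ?V \<subseteq> cdom (end_chart n)"
    proof (rule image_subsetI)
      fix y :: C2 assume "y \<in> ?V"
      then have "0 < norm y" "norm y < 1" by auto
      then have "norm (?l y) > 1" unfolding norm_scaleR by (simp add: power2_eq_square field_simps)
      then show "?l y \<in> cdom (end_chart n)" by (simp add: end_chart_def)
    qed
  qed (auto simp: infinity_chart_def end_chart_def)
  have nx: "norm ?x = t" using t by (simp add: norm_prod_def)
  have x0: "?x \<noteq> 0" using t by (simp add: zero_prod_def)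
  have xV: "?x \<in> ?V" using t nx x0 by simp
  have pm: "preserves_metric (Xhat_atlas n) id h" using om by (simp add: orbifold_metric_def)
  note D = fun_cong[OF frechet_derivative_at[OF has_derivative_inversion[OF x0], symmetric]]
  have "h (end_chart n) (?l ?x) (frechet_derivative ?l (at ?x) (0, 1)) (frechet_derivative ?l (at ?x) (0, 1))
      = h (infinity_chart n) ?x (0, 1) (0, 1)"
    by (rule preserves_metricD[OF pm Xhat_atlas_charts(3) Xhat_atlas_charts(1) lift xV])
  moreover have "?l ?x = (of_real (1 / t), 0)"
    using t by (simp add: nx power2_eq_square scaleR_conv_of_real field_simps)
  moreover have "frechet_derivative ?l (at ?x) (0, 1) = (0, of_real (1 / t\<^sup>2))"
    unfolding D nx by (simp add: inner_prod_def scaleR_conv_of_real divide_inverse)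
  ultimately have "h (infinity_chart n) ?x (0, 1) (0, 1) =
      h (end_chart n) (of_real (1 / t), 0) (0, of_real (1 / t\<^sup>2)) (0, of_real (1 / t\<^sup>2))" by simp
  moreover have nz: "norm (complex_of_real (1 / t), 0::complex) > 1"
    using t by (simp add: norm_divide)
  moreover have "h (end_chart n) (of_real (1 / t), 0) (0, of_real (1 / t\<^sup>2)) (0, of_real (1 / t\<^sup>2)) =
      \<phi> (Some (lebrun_orbit n (of_real (1 / t), 0))) / t ^ 4"
    unfolding h[OF nz] using t
    by (simp add: norm_prod_def lebrun_tensor_eq_radial_form radial_form_def inner_prod_def inner_complex_def cscale_def
        zero_prod_def norm_divide power_divide power4_eq_xxxx power2_eq_square)
  ultimately show ?thesis using t by simp
qed

text \<open>Over \<open>\<zeta> = 0\<close> the base vector is \<open>(1, 0)\<close>, and for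
  \<open>w = t > 0\<close> the condition on the phase becomes \<open>c ^ n = 1\<close>. Positivity
  of \<open>t\<close> keeps the radius away from \<open>1\<close>, where orbits are whole
  circles.\<close>

lemma tube_chart_axis:
  assumes "t > 0"
  shows "cmap (tube_chart1 n) (0, of_real t) = Some (lebrun_orbit n (of_real (sqrt (1 + t\<^sup>2)), 0))"
proof -
  have "norm (complex_of_real (sqrt (1 + t\<^sup>2)), 0::complex) \<noteq> 1"
    using assms by (simp add: norm_prod_def)
  then show ?thesis
    using assms
    by (auto simp: tube_chart1_def tube_point_def lebrun_orbit_def norm_prod_def cscale_def scaleR_conv_of_real mult.commute)
qed


theorem theorem1p4:
  fixes n :: nat
    and g ghat :: "(C2, point) orbitensor"
    and u :: "point \<Rightarrow> real"
  assumes "n > 1"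
    and "lebrun_metric n g"
    and "orbifold_conformal_compactification n g u ghat"
  shows "\<not> (\<exists>h. yamabe_solution (Xhat_atlas n) ghat h \<and> SU2_invariant n h)"
proof
  assume "\<exists>h. yamabe_solution (Xhat_atlas n) ghat h \<and> SU2_invariant n h"
  then obtain h where om: "orbifold_metric (Xhat_atlas n) h"
    and conf: "conformal_metrics (Xhat_atlas n) ghat h"
    and csc: "constant_scalar_curvature (Xhat_atlas n) h"
    and inv: "SU2_invariant n h"
    by (auto simp: yamabe_solution_def)
  note n = assms(1)
  define m where "m = real n - 1"
  have m: "m \<ge> 1" using n by (simp add: m_def)
  obtain f where f: "orbifold_smooth (Xhat_atlas n) f"
    and f_pos: "\<And>C x. C \<in> Xhat_atlas n \<Longrightarrow> x \<in> cdom C \<Longrightarrow> f (cmap C x) > 0"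
    and hf: "\<And>C x v w. C \<in> Xhat_atlas n \<Longrightarrow> x \<in> cdom C \<Longrightarrow> h C x v w = f (cmap C x) * ghat C x v w"
    using conf unfolding conformal_metrics_def by blast
  obtain c where c: "\<And>C x. C \<in> Xhat_atlas n \<Longrightarrow> x \<in> cdom C \<Longrightarrow> scalar_curvature (h C) x = c"
    using csc unfolding constant_scalar_curvature_def by blast
  have u: "orbifold_smooth (X_atlas n) u"
    and u_pos: "\<And>C x. C \<in> X_atlas n \<Longrightarrow> x \<in> cdom C \<Longrightarrow> u (cmap C x) > 0"
    and ghat: "\<And>C x v w. C \<in> X_atlas n \<Longrightarrow> x \<in> cdom C \<Longrightarrow> ghat C x v w = (u (cmap C x))\<^sup>2 * g C x v w"
    using assms(3) unfolding orbifold_conformal_compactification_def by blast+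
  \<comment> \<open>On the smooth part \<open>h = f ghat = f u^2 g\<close>, so this is the conformal
    factor of \<open>h\<close> over the LeBrun metric.\<close>
  define \<phi> where "\<phi> x = f x * (u x)\<^sup>2" for x
  have h_end: "h (end_chart n) z v w = \<phi> (Some (lebrun_orbit n z)) * lebrun_tensor n z v w" if "norm z > 1" for z v w
  proof -
    have z: "z \<in> cdom (end_chart n)" using that by (simp add: end_chart_def)
    have E: "end_chart n \<in> X_atlas n" by (simp add: X_atlas_def)
    have "g (end_chart n) z = lebrun_tensor n z"
      using assms(2) z by (simp add: lebrun_metric_def)
    then show ?thesis
      using hf[OF Xhat_atlas_charts(1) z] ghat[OF E z] by (simp add: \<phi>_def end_chart_def)
  qed

  txt \<open>On the fibre \<open>\<zeta> = 0\<close> of the tube chart the coordinate is \<open>t = sqrt (s - 1)\<close>, so \<open>v\<close> is \<open>V\<close> as a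
    function of \<open>t\<close>, smooth up to \<open>t = 0\<close>.\<close>
  define tube where "tube t = cmap (tube_chart1 n) (0 + t *\<^sub>R (0, 1))" for t
  have T: "tube_chart1 n \<in> X_atlas n" and dom_T: "cdom (tube_chart1 n) = UNIV"
    by (simp_all add: X_atlas_def tube_chart1_def)
  have "smooth_on UNIV (\<lambda>x. f (cmap (tube_chart1 n) x))"
    using f Xhat_atlas_charts(2)[of n] unfolding orbifold_smooth_def dom_T[symmetric] by blast
  from smooth_on_line[OF this, of 0 "(0, 1)"] obtain f1 f2 where
    f1: "((\<lambda>t. f (tube t)) has_real_derivative f1 t) (at t)" and f2: "(f1 has_real_derivative f2 t) (at t)" for t
    unfolding tube_def by auto
  have "smooth_on UNIV (\<lambda>x. u (cmap (tube_chart1 n) x))"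
    using u T unfolding orbifold_smooth_def dom_T[symmetric] by blast
  from smooth_on_line[OF this, of 0 "(0, 1)"] obtain u1 u2 where
    u1: "((\<lambda>t. u (tube t)) has_real_derivative u1 t) (at t)" and u2: "(u1 has_real_derivative u2 t) (at t)" for t
    unfolding tube_def by auto
  have ft: "f (tube t) > 0" for t
    unfolding tube_def by (rule f_pos[OF Xhat_atlas_charts(2)]) (simp add: dom_T)
  have ut: "u (tube t) > 0" for t
    unfolding tube_def by (rule u_pos[OF T]) (simp add: dom_T)
  define V where "V t = u (tube t) * sqrt (f (tube t))" for t
  have V_pos: "V t > 0" for t using ft ut by (simp add: V_def)
  define V1 where "V1 t = u1 t * sqrt (f (tube t)) + f1 t / (2 * sqrt (f (tube t))) * u (tube t)" for t
  have sqrt_f: "((\<lambda>t. sqrt (f (tube t))) has_real_derivative f1 t / (2 * sqrt (f (tube t)))) (at t)" for t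
    by (rule DERIV_cong[OF DERIV_chain2[OF DERIV_real_sqrt[OF ft] f1]]) (simp add: field_simps)
  have dV: "(V has_real_derivative V1 t) (at t)" for t
    unfolding V_def V1_def by (rule DERIV_mult[OF u1 sqrt_f])
  \<comment> \<open>The second derivative serves twice: it makes \<open>v\<close> twice
    differentiable for \<open>s > 1\<close>, and it makes \<open>V1\<close> continuous at
    \<open>0\<close>.\<close>
  have "\<exists>d. (V1 has_real_derivative d) (at t)" for t
  proof -
    have "2 * sqrt (f (tube t)) \<noteq> 0" using ft[of t] by simp
    then show ?thesis
      unfolding V1_def
      by (intro exI) (rule DERIV_add[OF DERIV_mult[OF u2 sqrt_f] DERIV_mult[OF DERIV_divide[OF f2 DERIV_cmult[OF sqrt_f]] u1]])
  qed
  then have dV1: "(V1 has_real_derivative deriv V1 t) (at t)" for t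
    by (simp add: DERIV_deriv_iff_has_field_derivative)

  define v where "v s = V (sqrt (s - 1))" for s
  define v1 where "v1 s = V1 (sqrt (s - 1)) * (inverse (sqrt (s - 1)) / 2)" for s
  have sq: "((\<lambda>s. sqrt (s - 1)) has_real_derivative inverse (sqrt (s - 1)) / 2) (at s)" if "s > 1" for s
    by (rule DERIV_cong[OF DERIV_chain2[OF DERIV_real_sqrt DERIV_diff[OF DERIV_ident DERIV_const]]])
       (use that in simp_all)
  have dv: "(v has_real_derivative v1 s) (at s)" if "s > 1" for s
    unfolding v_def v1_def by (rule DERIV_chain2[OF dV sq[OF that]])
  have dv1: "(v1 has_real_derivative deriv v1 s) (at s)" if s: "s > 1" for s
  proof -
    have "sqrt (s - 1) \<noteq> 0" using s by simp
    then have "\<exists>d. (v1 has_real_derivative d) (at s)"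
      unfolding v1_def
      by (intro exI) (rule DERIV_mult[OF DERIV_chain2[OF dV1 sq[OF s]] DERIV_cdivide[OF DERIV_inverse_fun[OF sq[OF s]]]])
    then show ?thesis by (simp add: DERIV_deriv_iff_has_field_derivative)
  qed
  \<comment> \<open>No restriction on \<open>s\<close>: \<open>sqrt\<close> is total and
    \<open>V\<close> is positive on the whole line.\<close>
  have v_pos: "v s > 0" for s by (simp add: v_def V_pos)
  have v_sq: "(v s)\<^sup>2 = \<phi> (Some (lebrun_orbit n (of_real (sqrt s), 0)))" if "s > 1" for s
  proof -
    have "tube (sqrt (s - 1)) = Some (lebrun_orbit n (of_real (sqrt s), 0))"
      using tube_chart_axis[of "sqrt (s - 1)" n] that
      by (simp add: tube_def scaleR_conv_of_real zero_prod_def)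
    then show ?thesis
      using ft[of "sqrt (s - 1)"] by (simp add: v_def V_def \<phi>_def power_mult_distrib mult.commute)
  qed

  \<comment> \<open>The radial Yamabe equation\<close>
  define F1 where "F1 s = - (real n - 2) / s\<^sup>2 - 2 * (1 - real n) / s ^ 3" for s
  define F2 where "F2 s = 2 * (real n - 2) / s ^ 3 + 6 * (1 - real n) / s ^ 4" for s
  have dF: "(profile n has_real_derivative F1 s) (at s)" if "s > 1" for s
    unfolding profile_def[abs_def] F1_def using that
    by (auto intro!: derivative_eq_intros simp: field_simps power2_eq_square power3_eq_cube)
  have dF1: "(F1 has_real_derivative F2 s) (at s)" if "s > 1" for s
    unfolding F1_def F2_def using that
    by (auto intro!: derivative_eq_intros simp: field_simps power2_eq_square power3_eq_cube power4_eq_xxxx)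
  have ode: "(2 * s + m - 1) * v1 s + (s - 1) * (s + m) * deriv v1 s = - (c / 24) * s * v s ^ 3" if s: "s > 1" for s
  proof -
    let ?r = "sqrt s"
    have r2: "?r\<^sup>2 = s" and r1: "?r > 1" using s by simp_all
    have "scalar_curvature (h (end_chart n)) (of_real ?r, 0) * v (?r\<^sup>2) ^ 3 =
      - 24 / ?r\<^sup>2 * ((2 * ?r\<^sup>2 * profile n (?r\<^sup>2) + (?r\<^sup>2)\<^sup>2 * F1 (?r\<^sup>2)) * v1 (?r\<^sup>2) + (?r\<^sup>2)\<^sup>2 * profile n (?r\<^sup>2) * deriv v1 (?r\<^sup>2))
      + 4 * v (?r\<^sup>2) * (2 - (2 * profile n (?r\<^sup>2) + 4 * ?r\<^sup>2 * F1 (?r\<^sup>2) + (?r\<^sup>2)\<^sup>2 * F2 (?r\<^sup>2))) / ?r\<^sup>2"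
    proof (rule scalar_curvature_conformal[of "{1<..}"])
      show "h (end_chart n) x X Y = (v (x \<bullet> x))\<^sup>2 *
        radial_form 1 ((1 / profile n (x \<bullet> x) - 1) / (x \<bullet> x)) ((profile n (x \<bullet> x) - 1) / (x \<bullet> x)) x X Y"
        if "x \<bullet> x \<in> {1<..}" for x X Y
      proof -
        have xx: "x \<bullet> x > 1" using that by simp
        then have nx: "norm x > 1" by (simp add: norm_eq_sqrt_inner)
        then have x0: "x \<noteq> 0" by auto
        have "\<phi> (Some (lebrun_orbit n x)) = (v (x \<bullet> x))\<^sup>2"
          using SU2_invariant_conformal_factor_radial[where \<phi> = \<phi>, OF n inv h_end nx]
          by (simp add: v_sq[OF xx] norm_eq_sqrt_inner)
        then show ?thesis
          by (simp add: h_end[OF nx] lebrun_tensor_eq_radial_form[OF x0])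
      qed
    qed (use s n in \<open>simp_all add: v_pos dv dv1 dF dF1 profile_pos\<close>)
    moreover have "scalar_curvature (h (end_chart n)) (of_real ?r, 0) = c"
      using r1 by (intro c[OF Xhat_atlas_charts(1)]) (simp add: end_chart_def)
    ultimately have *: "c * v s ^ 3 =
      - 24 / s * ((2 * s * profile n s + s\<^sup>2 * F1 s) * v1 s + s\<^sup>2 * profile n s * deriv v1 s)
      + 4 * v s * (2 - (2 * profile n s + 4 * s * F1 s + s\<^sup>2 * F2 s)) / s"
      unfolding r2 by simp
    \<comment> \<open>With \<open>s^2 F = P\<close>, the middle identity is
      \<open>(s^2 F)'' = 2\<close>. It expresses that the LeBrun metric is scalar-flat, and it
      removes the term linear in \<open>v\<close>.\<close>
    have e: "2 * s * profile n s + s\<^sup>2 * F1 s = 2 * s + m - 1"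
      "2 * profile n s + 4 * s * F1 s + s\<^sup>2 * F2 s = 2"
      "s\<^sup>2 * profile n s = (s - 1) * (s + m)"
      using s by (simp_all add: profile_def F1_def F2_def m_def field_simps power2_eq_square power3_eq_cube power4_eq_xxxx)
    have "c * v s ^ 3 = - 24 / s * ((2 * s + m - 1) * v1 s + (s - 1) * (s + m) * deriv v1 s)"
      using * unfolding e by simp
    then show ?thesis using s by (simp add: field_simps)
  qed

  define y where "y s = (s - 1) * (s + m) * v1 s" for s
  have dy: "(y has_real_derivative - (c / 24) * s * v s ^ 3) (at s)" if s: "s > 1" for s
  proof -
    have "((\<lambda>s. (s - 1) * (s + m)) has_real_derivative 2 * s + m - 1) (at s)"
      by (auto intro!: derivative_eq_intros)
    from DERIV_mult[OF this dv1[OF s]] show ?thesis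
      unfolding y_def ode[OF s, symmetric] by (simp add: mult.commute)
  qed

  \<comment> \<open>Asymptotics at the projective line\<close>
  have sqrt_lim: "((\<lambda>s. sqrt (s - 1)) \<longlongrightarrow> 0) (at_right 1)" by real_asymp
  have "isCont V 0" "isCont V1 0" using dV dV1 by (auto intro: DERIV_isCont)
  from this[THEN isCont_tendsto_compose, OF sqrt_lim]
  have V_lim: "((\<lambda>s. V (sqrt (s - 1))) \<longlongrightarrow> V 0) (at_right 1)"
    and V1_lim: "((\<lambda>s. V1 (sqrt (s - 1))) \<longlongrightarrow> V1 0) (at_right 1)" .
  have v_near: "v \<in> O[at_right 1](\<lambda>_. 1)"
    by (rule bigoI_tendsto[of _ _ "V 0"]) (use V_lim in \<open>simp_all add: v_def\<close>)
  \<comment> \<open>With \<open>t = sqrt (s - 1)\<close>, the chain rule gives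
    \<open>v' = V1 t / (2 t)\<close>, while \<open>P = t^2 (s + m)\<close>; so
    \<open>P v' / t\<close> has a finite limit.\<close>
  have y_near: "y \<in> O[at_right 1](\<lambda>s. sqrt (s - 1))"
  proof (rule bigoI_tendsto)
    have "((\<lambda>s. (s + m) * V1 (sqrt (s - 1)) / 2) \<longlongrightarrow> (1 + m) * V1 0 / 2) (at_right 1)"
      by (intro tendsto_intros V1_lim) simp
    then show "((\<lambda>s. y s / sqrt (s - 1)) \<longlongrightarrow> (1 + m) * V1 0 / 2) (at_right 1)"
    proof (rule Lim_transform_eventually)
      show "\<forall>\<^sub>F s in at_right 1. (s + m) * V1 (sqrt (s - 1)) / 2 = y s / sqrt (s - 1)"
        using eventually_at_right_less[of 1]
      proof eventually_elim
        case (elim s)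
        then have "sqrt (s - 1) * sqrt (s - 1) = s - 1" "sqrt (s - 1) \<noteq> 0" by simp_all
        then show ?case unfolding y_def v1_def by (simp add: field_simps) 
      qed
    qed
    show "\<forall>\<^sub>F s in at_right 1. sqrt (s - 1) \<noteq> 0"
      using eventually_at_right_less[of 1] by eventually_elim simp
  qed

  txt \<open>At the added point, \<open>t = 1 / r\<close> is the coordinate on the axis, and \<open>v\<^sup>2 = t\<^sup>4 G t\<close> with \<open>G 0 > 0\<close>.\<close>
  define G where "G t = h (infinity_chart n) ((0, 0) + t *\<^sub>R (1, 0)) (0, 1) (0, 1)" for t
  have rm: "riemannian_metric_on (ball 0 1) (h (infinity_chart n))"
    using om Xhat_atlas_charts(3)[of n] unfolding orbifold_metric_def by (fastforce simp: infinity_chart_def)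
  have dom_G: "(0, 0) + t *\<^sub>R (1, 0) \<in> (ball 0 1 :: C2 set)" if "0 \<le> t" "t < 1" for t
    using that by simp
  have "smooth_on (ball 0 1) (\<lambda>x. h (infinity_chart n) x (0, 1) (0, 1))"
    using rm unfolding riemannian_metric_on_def by blast
  from smooth_on_line[OF this, of "(0, 0)" "(1, 0)"] obtain G1 G2 where
    "(0, 0) + t *\<^sub>R (1, 0) \<in> (ball 0 1 :: C2 set) \<Longrightarrow> (G has_real_derivative G1 t) (at t)"
    "(0, 0) + t *\<^sub>R (1, 0) \<in> (ball 0 1 :: C2 set) \<Longrightarrow> (G1 has_real_derivative G2 t) (at t)" for t
    unfolding G_def by blast
  then have dG: "(G has_real_derivative G1 t) (at t)" and dG1: "(G1 has_real_derivative G2 t) (at t)"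
    if "0 \<le> t" "t < 1" for t
    using dom_G[OF that] by blast+
  have G_pos: "G t > 0" if "0 \<le> t" "t < 1" for t
    using rm dom_G[OF that] unfolding G_def riemannian_metric_on_def by (auto simp: zero_prod_def)
  \<comment> \<open>In the coordinate \<open>t = 1 / sqrt s\<close> the claim will be
    \<open>v = t^2 K t\<close>; since \<open>G 0 > 0\<close>, the root is differentiable up to
    \<open>t = 0\<close>.\<close>
  define K where "K t = sqrt (G t)" for t
  define K1 where "K1 t = G1 t / (2 * sqrt (G t))" for t
  have dK: "(K has_real_derivative K1 t) (at t)" if "0 \<le> t" "t < 1" for t
    unfolding K_def K1_def
    by (rule DERIV_cong[OF DERIV_chain2[OF DERIV_real_sqrt[OF G_pos[OF that]] dG[OF that]]]) (simp add: field_simps)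
  have "isCont K 0" using dK[of 0] by (auto intro: DERIV_isCont)
  have "isCont G 0" "isCont G1 0" using dG[of 0] dG1[of 0] by (auto intro: DERIV_isCont)
  then have "isCont K1 0"
    unfolding K1_def using G_pos[of 0] by (intro isCont_divide isCont_mult continuous_real_sqrt continuous_const) simp_all
  have w_lim: "((\<lambda>s. inverse (sqrt s)) \<longlongrightarrow> 0) at_top" by real_asymp
  have K_lim: "((\<lambda>s. K (inverse (sqrt s))) \<longlongrightarrow> K 0) at_top"
    by (rule isCont_tendsto_compose[OF \<open>isCont K 0\<close> w_lim])
  have K1_lim: "((\<lambda>s. K1 (inverse (sqrt s))) \<longlongrightarrow> K1 0) at_top"
    by (rule isCont_tendsto_compose[OF \<open>isCont K1 0\<close> w_lim])
  have w: "0 < inverse (sqrt s)" "inverse (sqrt s) < 1" if "s > 1" for s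
    using that by (simp_all add: inverse_less_1_iff)
  have w2: "inverse (sqrt s) * inverse (sqrt s) = inverse s" if "s > 1" for s
    using that by (simp add: inverse_mult_distrib[symmetric] del: inverse_mult_distrib)
  have v_K: "v s = K (inverse (sqrt s)) * inverse s" if s: "s > 1" for s
  proof -
    have "(v s)\<^sup>2 = inverse (sqrt s) ^ 4 * G (inverse (sqrt s))"
      using infinity_chart_conformal_factor[where \<phi> = \<phi>, OF om h_end w[OF s]] v_sq[OF s]
      by (simp add: G_def scaleR_conv_of_real inverse_eq_divide)
    also have "\<dots> = (K (inverse (sqrt s)) * inverse s)\<^sup>2"
    proof -
      have "inverse (sqrt s) ^ 4 = (inverse s)\<^sup>2"
        unfolding w2[OF s, symmetric] by (simp only: power4_eq_xxxx power2_eq_square mult.assoc)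
      then show ?thesis
        using less_imp_le[OF G_pos[of "inverse (sqrt s)"]] w[OF s] by (simp add: K_def power_mult_distrib)
    qed
    finally have "(v s)\<^sup>2 = (K (inverse (sqrt s)) * inverse s)\<^sup>2" .
    moreover have "0 \<le> K (inverse (sqrt s)) * inverse s"
      unfolding K_def using less_imp_le[OF G_pos[of "inverse (sqrt s)"]] w[OF s] s by simp
    ultimately show ?thesis
      by (rule power2_eq_imp_eq[OF _ less_imp_le[OF v_pos]])
  qed
  \<comment> \<open>Differentiating the expression from the chart at the added point; uniqueness of
    derivatives identifies the result with \<open>v1\<close>, which was defined through the tube
    chart.\<close>
  have v1_K: "v1 s = K1 (inverse (sqrt s)) * (- (inverse (sqrt s) ^ 3) / 2) * inverse s - K (inverse (sqrt s)) * (inverse s)\<^sup>2"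
    if s: "s > 1" for s
  proof -
    have dw: "((\<lambda>s. inverse (sqrt s)) has_real_derivative - (inverse (sqrt s) ^ 3) / 2) (at s)"
      using s by (auto intro!: derivative_eq_intros simp: power3_eq_cube)
    have di: "(inverse has_real_derivative - ((inverse s)\<^sup>2)) (at s)"
      using s by (auto intro!: derivative_eq_intros simp: power2_eq_square)
    have "((\<lambda>s. K (inverse (sqrt s)) * inverse s) has_real_derivative
       K1 (inverse (sqrt s)) * (- (inverse (sqrt s) ^ 3) / 2) * inverse s - K (inverse (sqrt s)) * (inverse s)\<^sup>2) (at s)"
      by (rule DERIV_cong[OF DERIV_mult[OF DERIV_chain2[OF dK dw] di]]) (use w[OF s] in \<open>simp_all add: algebra_simps\<close>)
    then have "(v has_real_derivative
       K1 (inverse (sqrt s)) * (- (inverse (sqrt s) ^ 3) / 2) * inverse s - K (inverse (sqrt s)) * (inverse s)\<^sup>2) (at s)"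
      by (rule has_field_derivative_transform_within_open[of _ _ _ "{1<..}"]) (use s v_K in auto)
    then show ?thesis by (rule DERIV_unique[OF dv[OF s]])
  qed
  have v_far: "v \<in> O[at_top](\<lambda>s. 1 / s)"
  proof (rule bigoI_tendsto)
    show "((\<lambda>s. v s / (1 / s)) \<longlongrightarrow> K 0) at_top"
      using K_lim
    proof (rule Lim_transform_eventually)
      show "\<forall>\<^sub>F s in at_top. K (inverse (sqrt s)) = v s / (1 / s)"
        using eventually_gt_at_top[of 1] by eventually_elim (simp add: v_K)
    qed
    show "\<forall>\<^sub>F s in at_top. 1 / s \<noteq> (0::real)"
      using eventually_gt_at_top[of 1] by eventually_elim simp
  qed
  \<comment> \<open>\<open>P\<close> grows like \<open>s^2\<close> and \<open>v'\<close> behaves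
    like \<open>- K 0 / s^2\<close>, the \<open>K1\<close> term carrying an extra factor
    \<open>1 / sqrt s\<close>; thus \<open>y\<close> tends to \<open>- K 0\<close>.\<close>
  have y_far: "y \<in> O[at_top](\<lambda>_. 1)"
  proof (rule bigoI_tendsto)
    have "((\<lambda>s. (s - 1) * (s + m) / s\<^sup>2) \<longlongrightarrow> 1) at_top" by real_asymp
    then have "((\<lambda>s. (s - 1) * (s + m) / s\<^sup>2 * (- (K1 (inverse (sqrt s)) * inverse (sqrt s)) / 2 - K (inverse (sqrt s))))
        \<longlongrightarrow> 1 * (- (K1 0 * 0) / 2 - K 0)) at_top"
      by (intro tendsto_intros K_lim K1_lim w_lim) simp_all
    then show "((\<lambda>s. y s / 1) \<longlongrightarrow> 1 * (- (K1 0 * 0) / 2 - K 0)) at_top"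
    proof (rule Lim_transform_eventually)
      show "\<forall>\<^sub>F s in at_top. (s - 1) * (s + m) / s\<^sup>2 * (- (K1 (inverse (sqrt s)) * inverse (sqrt s)) / 2 - K (inverse (sqrt s))) = y s / 1"
        using eventually_gt_at_top[of 1]
      proof eventually_elim
        case (elim s)
        have "inverse (sqrt s) ^ 3 = inverse (sqrt s) * inverse s"
          unfolding power3_eq_cube w2[OF elim] by (rule mult.commute)
        then show ?case
          using elim by (simp add: y_def v1_K field_simps power2_eq_square)
      qed
    qed
  qed simp

  show False
  proof (rule pohozaev_obstruction[OF m v_pos _ dy v_near y_near v_far y_far])
    show "(v has_real_derivative y s / ((s - 1) * (s + m))) (at s)" if "s > 1" for s
      using dv[OF that] that m by (simp add: y_def)
  qed
qed

end
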